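(* Let $P$ be a tree poset of height $k$. Then, as $n\to\infty$, the number of $P$-free set systems $\mathcal{F}\subseteq 2^{[n]}$ is $$2^{(1+o(1))(k-1)\binom{n}{\lfloor n/2\rfloor}}.$$
   Context: All posets are finite. A poset $Q$ contains a poset $P$ if there is an injective map $\pi:P\to Q$ with $\pi(A)\le \pi(B)$ whenever $A\le B$; otherwise $Q$ is $P$-free. A set system $\mathcal{F}\subseteq 2^{[n]}$ is regarded as a poset ordered by inclusion. The Hasse diagram of $P$ is the graph on $P$ with an edge between $x$ and $y$ whenever one covers the other ($x$ covers $z$ if $x>z$ and there is no $y$ with $x>y>z$). $P$ is a tree poset if its Hasse diagram is a tree. The height of $P$ is the number of elements in a longest chain of $P$. *)

theory Defs
  imports Complex_Main "HOL-Library.Landau_Symbols"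
begin

text \<open>
  A poset is represented by its non-strict order relation; its ground set is the
  field of the relation, which contains every element by reflexivity.
\<close>

definition poset_contains :: "'b rel \<Rightarrow> 'a rel \<Rightarrow> bool" where
  "poset_contains Q P \<longleftrightarrow>
     (\<exists>\<pi>. inj_on \<pi> (Field P) \<and> \<pi> ` Field P \<subseteq> Field Q \<and>
          (\<forall>A B. (A, B) \<in> P \<longrightarrow> (\<pi> A, \<pi> B) \<in> Q))"

abbreviation poset_free :: "'a rel \<Rightarrow> 'b rel \<Rightarrow> bool" where
  "poset_free P Q \<equiv> \<not> poset_contains Q P"

definition inclusion_order :: "'a set set \<Rightarrow> 'a set rel" where
  "inclusion_order \<F> = relation_of (\<subseteq>) \<F>"

definition poset_less :: "'a rel \<Rightarrow> 'a \<Rightarrow> 'a \<Rightarrow> bool" where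
  "poset_less P x y \<longleftrightarrow> (x, y) \<in> P \<and> x \<noteq> y"

definition covers :: "'a rel \<Rightarrow> 'a \<Rightarrow> 'a \<Rightarrow> bool" where
  "covers P x z \<longleftrightarrow> poset_less P z x \<and> \<not> (\<exists>y. poset_less P z y \<and> poset_less P y x)"

text \<open>
  Simple graphs are given by a vertex set and a symmetric irreflexive edge relation.
\<close>

definition hasse_edges :: "'a rel \<Rightarrow> 'a rel" where
  "hasse_edges P = {(x, y). covers P x y \<or> covers P y x}"

definition graph_cycle :: "'a rel \<Rightarrow> 'a list \<Rightarrow> bool" where
  "graph_cycle E c \<longleftrightarrow>
     length c \<ge> 3 \<and> distinct c \<and> successively (\<lambda>x y. (x, y) \<in> E) c \<and> (last c, hd c) \<in> E"

definition graph_tree :: "'a set \<Rightarrow> 'a rel \<Rightarrow> bool" where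
  "graph_tree V E \<longleftrightarrow>
     V \<noteq> {} \<and> (\<forall>x\<in>V. \<forall>y\<in>V. (x, y) \<in> E\<^sup>*) \<and> \<not> (\<exists>c. graph_cycle E c)"

definition tree_poset :: "'a rel \<Rightarrow> bool" where
  "tree_poset P \<longleftrightarrow>
     finite (Field P) \<and> Partial_order P \<and> graph_tree (Field P) (hasse_edges P)"

definition poset_height :: "'a rel \<Rightarrow> nat" where
  "poset_height P = Max (card ` Chains P)"

end

theory Submission
  imports Defs "HOL-Combinatorics.Multiset_Permutations" "HOL-Real_Asymp.Real_Asymp"
begin

text \<open>
  The lower bound counts the subfamilies of the k - 1 middle levels.

  For the upper bound, consider the k-chains of a P-free family F. If some nonempty set of
  k-chains had the property that every member, in every position, can be completed to |P| different
  members in every other position, then P could be embedded greedily along its Hasse tree.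
  Peeling off poor positions one by one therefore produces O(|F|) pairs that hit every
  k-chain of F. Since F contains no long chain, |F| is O(N), where N is the central
  binomial coefficient, and deleting o(N) sets makes the graph E of these pairs have small
  maximum degree.

  Such sparsely hit families are counted by adaptive queries ``is w in F?'', which shrink the
  set A of undecided sets. While |A| exceeds (k - 1 + e)N, a Markov chain that walks along the
  elements of A on a random full chain shows that A is supersaturated: there are many sets at which
  a k-chain can start, and each of them has at least m (of order n) suitable successors, and so on.
  One round of queries grows an E-independent chain inside F; as it cannot reach length k, it gets
  stuck after at least m queries, of which only few (the chain and its E-neighbours) were answered
  positively. Hence all answers together carry only o(N) bits.
\<close>

section \<open>Counting sparsely hit families\<close>

text \<open>The accounting behind the parameters: 2^n is O(sqrt n * N), so querying everything takes
  O(N / sqrt n) rounds of about delta * n queries. If the degree bound L is about n^(1/4), a round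
  has O(n^(1/4)) positive answers at O(log n) bits each, in total O(N * n^(-1/4) * log n). Enforcing
  the degree bound deletes O(N / L) sets, again at O(log n) bits each. In this accounting any L well
  between log n and sqrt n / log n would do. Queries stop at about (k - 1 + e)N undecided sets,
  which are counted trivially; the leading constant comes from there alone. The obstacle is that
  \<open>E\<close> depends on the family and is not determined by the answers. It is therefore never
  recorded: the next query depends only on the undecided set, the known part and the current chain,
  and after a positive answer one merely distinguishes whether the queried set extends the chain or
  is a neighbour of it. Sets near the top and the empty set are split off beforehand, since the
  random walk needs every single transition and every single starting weight to be O(1 / n).\<close>

fun rich :: "nat \<Rightarrow> 'a::order set \<Rightarrow> nat \<Rightarrow> 'a set" where
  "rich m A 0 = A"
| "rich m A (Suc i) = {v \<in> A. m \<le> card {w \<in> rich m A i. v < w}}"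

lemma rich_subset: "rich m A i \<subseteq> A"
  by (cases i) auto

definition sparsely_hit :: "nat \<Rightarrow> nat \<Rightarrow> 'a::order set \<Rightarrow> 'a rel \<Rightarrow> bool" where
  "sparsely_hit k L F E \<longleftrightarrow> irrefl E \<and> sym E \<and> (\<forall>v. card {w \<in> F. (v, w) \<in> E} \<le> L) \<and>
     (\<forall>c. length c = k \<and> sorted_wrt (<) c \<and> set c \<subseteq> F \<longrightarrow> (\<exists>v\<in>set c. \<exists>w\<in>set c. (v, w) \<in> E))"

text \<open>\<open>A\<close> is what is still undecided and \<open>S\<close> what is known of the
  family outside \<open>A\<close>. The graph is quantified inside the set, so families with
  different graphs are counted together and the graph costs no bits.\<close>

definition sparse_families :: "nat \<Rightarrow> nat \<Rightarrow> 'a::order set \<Rightarrow> 'a set \<Rightarrow> 'a set \<Rightarrow> 'a set set" where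
  "sparse_families k L \<Omega> A S = {F. F \<subseteq> \<Omega> \<and> F - A = S \<and> (\<exists>E. sparsely_hit k L F E)}"

text \<open>
  The state during a round of queries that started with the undecided set A0: the set A is still
  undecided, S is the known part of F outside of A, and c is the E-independent chain found so far.
  Every other positive answer of the round was an E-neighbour of c, which bounds their number.
\<close>

definition round_families ::
    "nat \<Rightarrow> nat \<Rightarrow> 'a::order set \<Rightarrow> 'a set \<Rightarrow> 'a set \<Rightarrow> 'a set \<Rightarrow> 'a list \<Rightarrow> 'a set set" where
  "round_families k L \<Omega> A\<^sub>0 A S c = {F. F \<subseteq> \<Omega> \<and> F - A = S \<and> set c \<subseteq> F \<and>
     (\<exists>E. sparsely_hit k L F E \<and> (\<forall>v\<in>set c. \<forall>w\<in>set c. (v, w) \<notin> E) \<and>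
          (\<forall>u \<in> S \<inter> A\<^sub>0 - set c. \<exists>v\<in>set c. (v, u) \<in> E))}"

text \<open>\<open>S \<inter> A\<^sub>0\<close> holds the positive answers of the current round: at
  most \<open>k\<close> chain elements and at most \<open>L\<close> neighbours for each of them.
  This caps the number of factors \<open>mu\<close> that a round can cost.\<close>

lemma card_yes_le:
  assumes "F \<in> round_families k L \<Omega> A\<^sub>0 A S c" "finite \<Omega>" "length c \<le> k"
  shows "card (S \<inter> A\<^sub>0) \<le> k + k * L"
proof -
  obtain E where F: "F \<subseteq> \<Omega>" "F - A = S" "set c \<subseteq> F" and E: "sparsely_hit k L F E"
    and u: "\<forall>u \<in> S \<inter> A\<^sub>0 - set c. \<exists>v\<in>set c. (v, u) \<in> E"
    using assms(1) by (auto simp: round_families_def)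
  have fin: "finite F" using F assms by (auto intro: finite_subset)
  have "S \<inter> A\<^sub>0 \<subseteq> set c \<union> (\<Union>v\<in>set c. {w \<in> F. (v, w) \<in> E})" (is "_ \<subseteq> ?R")
    using u F by blast
  then have "card (S \<inter> A\<^sub>0) \<le> card ?R"
    by (rule card_mono[rotated]) (use fin in auto)
  also have "\<dots> \<le> card (set c) + card (\<Union>v\<in>set c. {w \<in> F. (v, w) \<in> E})"
    by (rule card_Un_le)
  also have "card (\<Union>v\<in>set c. {w \<in> F. (v, w) \<in> E}) \<le> (\<Sum>v\<in>set c. card {w \<in> F. (v, w) \<in> E})"
    by (rule card_UN_le) simp
  also have "\<dots> \<le> (\<Sum>v\<in>set c. L)"
    using E by (intro sum_mono) (auto simp: sparsely_hit_def)
  also have "\<dots> \<le> k * L"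
    using card_length[of c] assms(3) by (simp add: mult_le_mono1)
  finally show ?thesis using card_length[of c] assms(3) by simp
qed

text \<open>
  Potential argument: a query costs a factor lam, and a positive answer another factor mu. The
  condition on lam and mu reflects that a positive answer has two outcomes: the queried element is
  an E-neighbour of the chain, or it extends the chain.
\<close>

lemma round_families_bound:
  fixes \<Omega> :: "'a::order set" and B lam mu :: real
  assumes fin: "finite \<Omega>" and A0: "A\<^sub>0 \<subseteq> \<Omega>" and k: "1 \<le> k"
    and rich: "m \<le> card (rich m A\<^sub>0 (k - 1))"
    and lam: "1 + 2 / mu \<le> lam" and mu: "1 \<le> mu"
    and B: "\<And>A S. A \<subseteq> A\<^sub>0 \<Longrightarrow> card A = card A\<^sub>0 - m \<Longrightarrow> real (card (sparse_families k L \<Omega> A S)) \<le> B"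
    and "A \<subseteq> A\<^sub>0" "card A = card A\<^sub>0 - m + t" "t \<le> m" "sorted_wrt (<) c" "length c \<le> k"
      "c \<noteq> [] \<longrightarrow> last c \<in> rich m A\<^sub>0 (k - length c)" "set c \<subseteq> A\<^sub>0 - A"
      "card (S \<inter> A\<^sub>0) + r = k + k * L"
  shows "real (card (round_families k L \<Omega> A\<^sub>0 A S c)) \<le> B * lam ^ t * mu ^ r"
  using assms(8-)
\<comment> \<open>\<open>t\<close> is the number of queries left in the round, \<open>r\<close> the
  number of positive answers that \<open>card_yes_le\<close> still permits.\<close>
proof (induction t arbitrary: A S c r)
  case 0
  have "round_families k L \<Omega> A\<^sub>0 A S c \<subseteq> sparse_families k L \<Omega> A S"
    by (auto simp: round_families_def sparse_families_def)
  moreover have "finite (sparse_families k L \<Omega> A S)"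
    using fin by (intro finite_subset[OF _ finite_Pow_iff[THEN iffD2, OF fin]])
      (auto simp: sparse_families_def)
  ultimately have le: "real (card (round_families k L \<Omega> A\<^sub>0 A S c)) \<le> B"
    using B[of A S] 0 card_mono by (smt (verit) add_0_right of_nat_mono)
  have "B * 1 \<le> B * mu ^ r" using mu le by (intro mult_left_mono) auto
  then show ?case using le by simp
next
  case (Suc t)
  have B0: "0 \<le> B" 
  proof -
    obtain A' where "A' \<subseteq> A\<^sub>0" "card A' = card A\<^sub>0 - m"
      by (metis diff_le_self obtain_subset_with_card_n)
    then show ?thesis using B[of A' "{}"] by (smt (verit) of_nat_0_le_iff)
  qed
  have pos: "0 \<le> lam" using lam mu by (smt (verit) divide_nonneg_nonneg)
  have finA: "finite A\<^sub>0" using fin A0 finite_subset by auto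
  let ?R = "round_families k L \<Omega> A\<^sub>0"
  show ?case
  proof (cases "?R A S c = {}")
    case True
    then show ?thesis using B0 pos mu by simp
  next
    case False
    then obtain F where F: "F \<in> ?R A S c" by auto
    then obtain E where FO: "F \<subseteq> \<Omega>" "F - A = S" "set c \<subseteq> F" and E: "sparsely_hit k L F E"
      and free: "\<forall>v\<in>set c. \<forall>w\<in>set c. (v, w) \<notin> E"
      by (auto simp: round_families_def)
    \<comment> \<open>An \<open>E\<close>-independent chain of length \<open>k\<close> inside
      \<open>F\<close> would be a chain that \<open>E\<close> fails to hit.\<close>
    have len: "length c < k"
      using E free FO(3) Suc.prems(4,5) unfolding sparsely_hit_def by (metis le_neq_implies_less)
    \<comment> \<open>Candidates for the next chain element. Membership in \<open>rich m A i\<close>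
      means that \<open>i\<close> further extensions remain available, so the index drops by one
      with each element and reaches 0 at length \<open>k\<close>.\<close>
    define W where "W = {w \<in> rich m A\<^sub>0 (k - Suc (length c)). c \<noteq> [] \<longrightarrow> last c < w}"
    have "m \<le> card W"
    proof (cases "c = []")
      case True
      then show ?thesis using rich by (simp add: W_def)
    next
      case False
      have "k - length c = Suc (k - Suc (length c))" using len by simp
      then show ?thesis using False Suc.prems(6) by (auto simp: W_def)
    qed
    moreover have "card (A\<^sub>0 - A) < m"
    proof -
      have "card (A\<^sub>0 - A) = card A\<^sub>0 - card A"
        using Suc.prems finA by (simp add: card_Diff_subset finite_subset)
      then show ?thesis using Suc.prems(2,3) by linarith
    qed
    \<comment> \<open>There are at least \<open>m\<close> candidates but fewer than \<open>m\<close>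
      queries so far, so some candidate is still undecided; it is queried next.\<close>
    ultimately have "\<not> W \<subseteq> A\<^sub>0 - A"
      using finA by (meson card_mono finite_Diff le_trans not_le)
    moreover have WA: "W \<subseteq> A\<^sub>0" using rich_subset by (auto simp: W_def)
    ultimately obtain w where w: "w \<in> W" "w \<in> A" by auto
    define A' where "A' = A - {w}"
    have A': "A' \<subseteq> A\<^sub>0" "card A' = card A\<^sub>0 - m + t" "t \<le> m"
      using Suc.prems w finA by (auto simp: A'_def finite_subset)
    have wS: "w \<notin> S" using w FO by auto
    have cardS: "card (insert w S \<inter> A\<^sub>0) = Suc (card (S \<inter> A\<^sub>0))"
      using wS w WA finA by (simp add: Int_insert_left_if1 subset_iff)
    have wc: "w \<notin> set c" using w Suc.prems by auto
    have sc: "sorted_wrt (<) (c @ [w])"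
    proof -
      have "x < w" if "x \<in> set c" for x
      proof -
        have ne: "c \<noteq> []" using that by auto
        then obtain c' where c': "c = c' @ [last c]" by (metis append_butlast_last_id)
        have "x \<le> last c"
        proof (cases "x = last c")
          case False
          then have "x \<in> set c'" using that c' by (metis Un_iff empty_iff insert_iff list.set(1) list.simps(15) set_append)
          then show ?thesis using Suc.prems(4) c' by (metis less_imp_le list.set_intros(1) sorted_wrt_append)
        qed simp
        moreover have "last c < w" using w ne by (simp add: W_def)
        ultimately show ?thesis by (rule le_less_trans)
      qed
      then show ?thesis using Suc.prems(4) by (simp add: sorted_wrt_append)
    qed
    let ?R1 = "?R A' S c" and ?R2 = "?R A' (insert w S) c" and ?R3 = "?R A' (insert w S) (c @ [w])"
    \<comment> \<open>Three outcomes: a negative answer, a neighbour of the chain, or a new chain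
      element. The last two give the same new \<open>S\<close> and differ only in the chain.\<close>
    have "?R A S c \<subseteq> ?R1 \<union> (?R2 \<union> ?R3)"
    proof
      fix F assume "F \<in> ?R A S c"
      then obtain E where FO: "F \<subseteq> \<Omega>" "F - A = S" "set c \<subseteq> F" and E: "sparsely_hit k L F E"
      and free: "\<forall>v\<in>set c. \<forall>w\<in>set c. (v, w) \<notin> E"
      and u: "\<forall>u \<in> S \<inter> A\<^sub>0 - set c. \<exists>v\<in>set c. (v, u) \<in> E"
        by (auto simp: round_families_def)
      have E': "sym E" "irrefl E" using E by (auto simp: sparsely_hit_def)
      consider "w \<notin> F" | "w \<in> F" "\<exists>v\<in>set c. (v, w) \<in> E" | "w \<in> F" "\<not> (\<exists>v\<in>set c. (v, w) \<in> E)"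
        by auto
      then show "F \<in> ?R1 \<union> (?R2 \<union> ?R3)"
      proof cases
        case 1
        then have "F - A' = S" using FO by (auto simp: A'_def)
        then have "F \<in> ?R1" using FO E free u unfolding round_families_def by blast
        then show ?thesis by simp
      next
        case 2
        then have "F - A' = insert w S" using FO w by (auto simp: A'_def)
        moreover have "\<forall>u \<in> insert w S \<inter> A\<^sub>0 - set c. \<exists>v\<in>set c. (v, u) \<in> E" using u 2 by auto
        ultimately have "F \<in> ?R2" using FO E free unfolding round_families_def by blast
        then show ?thesis by simp
      next
        case 3
        then have "F - A' = insert w S" using FO w by (auto simp: A'_def)
        moreover have "\<forall>u \<in> insert w S \<inter> A\<^sub>0 - set (c @ [w]). \<exists>v\<in>set (c @ [w]). (v, u) \<in> E"
          using u by auto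
        moreover have "\<forall>v\<in>set (c @ [w]). \<forall>w\<in>set (c @ [w]). (v, w) \<notin> E"
          using free 3 E' by (auto simp: irrefl_def dest: symD)
        moreover have "set (c @ [w]) \<subseteq> F" using 3 FO by auto
        ultimately have "F \<in> ?R3" using FO(1) E unfolding round_families_def by blast
        then show ?thesis by simp
      qed
    qed
    moreover have finR: "finite (?R A S c)" for A S c
      by (rule finite_subset[OF _ finite_Pow_iff[THEN iffD2, OF fin]]) (auto simp: round_families_def)
    ultimately have "card (?R A S c) \<le> card (?R1 \<union> (?R2 \<union> ?R3))"
      by (intro card_mono) auto
    also have "\<dots> \<le> card ?R1 + card (?R2 \<union> ?R3)" by (rule card_Un_le)
    also have "card (?R2 \<union> ?R3) \<le> card ?R2 + card ?R3" by (rule card_Un_le)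
    finally have c3: "real (card (?R A S c)) \<le> real (card ?R1) + (real (card ?R2) + real (card ?R3))"
      by linarith
    have r1: "real (card ?R1) \<le> B * lam ^ t * mu ^ r"
      by (rule Suc.IH[OF A' Suc.prems(4-6) _ Suc.prems(8)]) (use Suc.prems(7) in \<open>auto simp: A'_def\<close>)
    have lc: "length (c @ [w]) \<le> k" using len by simp
    show ?thesis
    proof (cases r)
      case 0
      \<comment> \<open>With the budget used up, a further positive answer would contradict
        \<open>card_yes_le\<close>; only the negative branch is inhabited.\<close>
      then have big: "\<not> card (insert w S \<inter> A\<^sub>0) \<le> k + k * L" using cardS Suc.prems(8) by simp
      then have "?R2 = {}" "?R3 = {}"
        using card_yes_le[OF _ fin Suc.prems(5)] card_yes_le[OF _ fin lc] by blast+
      then have "real (card (?R A S c)) \<le> B * lam ^ t * mu ^ r" using c3 r1 by simp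
      also have "\<dots> \<le> B * lam ^ Suc t * mu ^ r"
        using B0 pos mu lam by (intro mult_right_mono mult_left_mono power_increasing) (auto intro: order_trans[OF _ lam])
      finally show ?thesis .
    next
      case (Suc r')
      have S': "card (insert w S \<inter> A\<^sub>0) + r' = k + k * L" using cardS Suc.prems(8) Suc by simp
      have r2: "real (card ?R2) \<le> B * lam ^ t * mu ^ r'"
        by (rule Suc.IH[OF A' Suc.prems(4-6) _ S']) (use Suc.prems(7) in \<open>auto simp: A'_def\<close>)
      have r3: "real (card ?R3) \<le> B * lam ^ t * mu ^ r'"
        by (rule Suc.IH[OF A' sc lc _ _ S']) (use Suc.prems(7) w WA in \<open>auto simp: A'_def W_def\<close>)
      have "real (card (?R A S c)) \<le> B * lam ^ t * mu ^ r + 2 * (B * lam ^ t * mu ^ r')"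
        using c3 r1 r2 r3 by linarith
      \<comment> \<open>Each positive branch saves one factor \<open>mu\<close>, so all three
        together cost the factor \<open>1 + 2 / mu\<close>, which \<open>lam\<close> covers.\<close>
      also have "\<dots> = B * lam ^ t * mu ^ r * (1 + 2 / mu)"
        using mu Suc by (simp add: field_simps)
      also have "\<dots> \<le> B * lam ^ t * mu ^ r * lam"
        using B0 pos mu lam by (intro mult_left_mono) auto
      finally show ?thesis by (simp add: mult_ac)
    qed
  qed
qed

text \<open>Rounds are repeated while more than \<open>T\<close> sets are undecided. Each removes
  exactly \<open>m\<close> of them, so there are at most \<open>card A div m\<close> rounds, each
  with its own budget of \<open>k + k * L\<close> positive answers; the last \<open>T\<close> sets
  contribute \<open>2 ^ T\<close>.\<close>

lemma sparse_families_bound: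
  fixes \<Omega> :: "'a::order set" and lam mu :: real
  assumes fin: "finite \<Omega>" and k: "1 \<le> k" and m: "1 \<le> m"
    and rich: "\<And>A. A \<subseteq> \<Omega> \<Longrightarrow> T < card A \<Longrightarrow> m \<le> card (rich m A (k - 1))"
    and lam: "1 + 2 / mu \<le> lam" and mu: "1 \<le> mu"
    and "A \<subseteq> \<Omega>"
  shows "real (card (sparse_families k L \<Omega> A S)) \<le> 2 ^ T * lam ^ card A * mu ^ ((k + k * L) * (card A div m))"
  using assms(7)
proof (induction "card A" arbitrary: A S rule: less_induct)
  case less
  have pos: "1 \<le> lam" using lam mu by (smt (verit) divide_nonneg_nonneg)
  have finA: "finite A" using less.prems fin finite_subset by auto
  show ?case
  proof (cases "T < card A")
    case False
    \<comment> \<open>Outside \<open>A\<close> every such family equals \<open>S\<close>, so it is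
      determined by its trace on \<open>A\<close>.\<close>
    have "sparse_families k L \<Omega> A S \<subseteq> (\<lambda>X. X \<union> S) ` Pow A"
      by (auto simp: sparse_families_def intro!: image_eqI[of _ _ "_ \<inter> A"])
    then have "card (sparse_families k L \<Omega> A S) \<le> card ((\<lambda>X. X \<union> S) ` Pow A)"
      by (intro card_mono) (use finA in auto)
    also have "\<dots> \<le> card (Pow A)" by (rule card_image_le) (use finA in auto)
    also have "\<dots> \<le> 2 ^ T" using False finA by (simp add: card_Pow)
    finally have "real (card (sparse_families k L \<Omega> A S)) \<le> real (2 ^ T)"
      by (rule of_nat_mono)
    also have "\<dots> = 2 ^ T * 1 * 1" by simp
    also have "\<dots> \<le> 2 ^ T * lam ^ card A * mu ^ ((k + k * L) * (card A div m))"
      using pos mu by (intro mult_mono) auto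
    finally show ?thesis .
  next
    case True
    note r = rich[OF less.prems True]
    also have "card (rich m A (k - 1)) \<le> card A" using finA rich_subset by (rule card_mono)
    finally have mA: "m \<le> card A" .
    define B where "B = 2 ^ T * lam ^ (card A - m) * mu ^ ((k + k * L) * ((card A - m) div m))"
    have B: "real (card (sparse_families k L \<Omega> A' S')) \<le> B" if "A' \<subseteq> A" "card A' = card A - m" for A' S'
      unfolding B_def that(2)[symmetric] by (rule less.hyps) (use that m mA less.prems in auto)
    have "sparse_families k L \<Omega> A S \<subseteq> round_families k L \<Omega> A A S []"
      by (auto simp: sparse_families_def round_families_def)
    then have "real (card (sparse_families k L \<Omega> A S)) \<le> real (card (round_families k L \<Omega> A A S []))"
      by (intro of_nat_mono card_mono finite_subset[OF _ finite_Pow_iff[THEN iffD2, OF fin]])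
        (auto simp: round_families_def)
    also have "\<dots> \<le> B * lam ^ m * mu ^ (k + k * L)"
    proof (cases "S \<inter> A = {}")
      case True
      show ?thesis
        by (rule round_families_bound[OF fin less.prems k r lam mu B]) (use mA True in auto)
    next
      case False
      then have "round_families k L \<Omega> A A S [] = {}" by (auto simp: round_families_def)
      then show ?thesis using pos mu by (simp add: B_def)
    qed
    also have "\<dots> = 2 ^ T * lam ^ (card A - m + m) * mu ^ ((k + k * L) * (Suc ((card A - m) div m)))"
      by (simp add: B_def power_add algebra_simps)
    also have "card A - m + m = card A" using mA by simp
    also have "Suc ((card A - m) div m) = card A div m" using mA m by (metis le_div_geq less_eq_Suc_le One_nat_def)
    finally show ?thesis .
  qed
qed

section \<open>Supersaturation\<close>

text \<open>
  Start a Markov chain with weights p and transition probabilities M v w / p v. Each step loses mass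
  at most 1, so mass sum p A - j survives j steps. If few elements are rich, then at some step the
  walk passes from a non-rich element to one of its fewer than m rich successors, which has small
  probability.
\<close>

lemma kernel_bound_if_few_rich:
  fixes M :: "'a::order \<Rightarrow> 'a \<Rightarrow> real" and p :: "'a \<Rightarrow> real"
  assumes fin: "finite A"
    and nonneg: "\<And>v w. 0 \<le> M v w" and less: "\<And>v w. M v w \<noteq> 0 \<Longrightarrow> v < w"
    and pos: "\<And>v. v \<in> A \<Longrightarrow> 0 < p v"
    and out: "\<And>v. v \<in> A \<Longrightarrow> (\<Sum>w\<in>A. M v w) \<le> p v"
    and inn: "\<And>w. w \<in> A \<Longrightarrow> (\<Sum>v\<in>A. M v w) \<le> p w"
    and defect: "(\<Sum>v\<in>A. p v - (\<Sum>w\<in>A. M v w)) \<le> 1"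
    and small: "\<And>v w. v \<in> A \<Longrightarrow> w \<in> A \<Longrightarrow> M v w \<le> \<eta> * p v" "\<And>v. v \<in> A \<Longrightarrow> p v \<le> \<eta>"
    and eta: "0 \<le> \<eta>"
    and few: "card (rich m A j) < m"
  shows "sum p A - real j \<le> real m * \<eta> * (1 + real j * sum p A)"
proof -
  \<comment> \<open>\<open>a i\<close> is the distribution of mass after \<open>i\<close> steps of
    the walk. It starts from \<open>p\<close>, whose total need not be 1.\<close>
  define a where "a = rec_nat p (\<lambda>_ f w. \<Sum>v\<in>A. f v * (M v w / p v))"
  have a0: "a 0 = p" and aS: "a (Suc i) = (\<lambda>w. \<Sum>v\<in>A. a i v * (M v w / p v))" for i
    by (simp_all add: a_def)
  \<comment> \<open>Domination by \<open>p\<close> survives a step because by \<open>inn\<close> the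
    total inflow into an element is at most its weight.\<close>
  have a: "0 \<le> a i v \<and> a i v \<le> p v" if "v \<in> A" for i v
    using that
  proof (induction i arbitrary: v)
    case 0
    then show ?case using pos[OF 0] by (simp add: a0)
  next
    case (Suc i)
    have "0 \<le> a (Suc i) v"
      unfolding aS using Suc nonneg pos by (intro sum_nonneg mult_nonneg_nonneg divide_nonneg_nonneg) (auto intro: less_imp_le)
    moreover have "a (Suc i) v \<le> (\<Sum>u\<in>A. M u v)"
      unfolding aS
    proof (rule sum_mono)
      fix u assume u: "u \<in> A"
      have "a i u * (M u v / p u) \<le> p u * (M u v / p u)"
        using Suc.IH[OF u] nonneg[of u v] pos[OF u] by (intro mult_right_mono) auto
      then show "a i u * (M u v / p u) \<le> M u v" using pos[OF u] by simp
    qed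
    ultimately show ?case using inn[OF Suc.prems] by linarith
  qed
  have swap: "sum (a (Suc i)) B = (\<Sum>v\<in>A. a i v / p v * (\<Sum>w\<in>B. M v w))" for i B
    unfolding aS by (subst sum.swap) (simp add: sum_distrib_left sum_divide_distrib mult_ac)
  have mass: "sum p A - real i \<le> sum (a i) A" for i
  proof (induction i)
    case 0
    show ?case by (simp add: a0)
  next
    case (Suc i)
    \<comment> \<open>The mass lost in one step is the defect, weighted by the ratios
      \<open>a i v / p v\<close>, which are at most 1.\<close>
    have "sum (a i) A - sum (a (Suc i)) A = (\<Sum>v\<in>A. a i v / p v * (p v - (\<Sum>w\<in>A. M v w)))"
      unfolding swap sum_subtractf[symmetric] using pos
      by (intro sum.cong refl) (force simp: field_simps)
    also have "\<dots> \<le> (\<Sum>v\<in>A. 1 * (p v - (\<Sum>w\<in>A. M v w)))"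
      using a pos out by (intro sum_mono mult_right_mono) auto
    also have "\<dots> \<le> 1" using defect by simp
    finally show ?case using Suc by simp
  qed
  have P0: "0 \<le> sum p A" using pos by (intro sum_nonneg) (auto intro: less_imp_le)
  \<comment> \<open>Mass arriving in \<open>rich m A l\<close> comes either from
    \<open>rich m A (Suc l)\<close> or from an element with fewer than \<open>m\<close> successors
    in \<open>rich m A l\<close>, each reached with probability at most
    \<open>\<eta>\<close>.\<close>
  have step: "sum (a (Suc i)) (rich m A l) \<le> sum (a i) (rich m A (Suc l)) + real m * \<eta> * sum p A" for i l
  proof -
    let ?V = "rich m A (Suc l)" and ?W = "rich m A l"
    have W: "?W \<subseteq> A" and V: "?V \<subseteq> A" by (rule rich_subset)+
    have fW: "finite ?W" using W fin finite_subset by auto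
    have 1: "a i v / p v * (\<Sum>w\<in>?W. M v w) \<le> a i v" if "v \<in> A" for v
    proof -
      have "(\<Sum>w\<in>?W. M v w) \<le> (\<Sum>w\<in>A. M v w)"
        by (rule sum_mono2) (use fin W nonneg in auto)
      then have "(\<Sum>w\<in>?W. M v w) \<le> p v" using out[OF that] by simp
      then have "a i v / p v * (\<Sum>w\<in>?W. M v w) \<le> a i v / p v * p v"
        using a[OF that] pos[OF that] by (intro mult_left_mono) auto
      then show ?thesis using pos[OF that] by simp
    qed
    have 2: "a i v / p v * (\<Sum>w\<in>?W. M v w) \<le> real m * \<eta> * p v" if "v \<in> A - ?V" for v
    proof -
      have v: "v \<in> A" and c: "card {w \<in> ?W. v < w} < m" using that by auto
      have "(\<Sum>w\<in>?W. M v w) = (\<Sum>w\<in>{w \<in> ?W. v < w}. M v w)"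
        by (rule sum.mono_neutral_right) (use fW less in auto)
      also have "\<dots> \<le> real (card {w \<in> ?W. v < w}) * (\<eta> * p v)"
        by (rule sum_bounded_above) (use W v small in auto)
      also have "\<dots> \<le> real m * (\<eta> * p v)"
        using c eta pos[OF v] by (intro mult_right_mono) auto
      finally have s: "(\<Sum>w\<in>?W. M v w) \<le> real m * (\<eta> * p v)" .
      have "a i v / p v \<le> 1" using a[OF v] pos[OF v] by simp
      then have "a i v / p v * (\<Sum>w\<in>?W. M v w) \<le> 1 * (\<Sum>w\<in>?W. M v w)"
        using nonneg by (intro mult_right_mono sum_nonneg) auto
      then show ?thesis using s by simp
    qed
    have "sum (a (Suc i)) ?W = (\<Sum>v\<in>?V. a i v / p v * (\<Sum>w\<in>?W. M v w)) + (\<Sum>v\<in>A - ?V. a i v / p v * (\<Sum>w\<in>?W. M v w))"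
      unfolding swap using sum.subset_diff[OF V fin] by (simp add: add.commute)
    also have "\<dots> \<le> (\<Sum>v\<in>?V. a i v) + (\<Sum>v\<in>A - ?V. real m * \<eta> * p v)"
      using V by (intro add_mono sum_mono 1 2) auto
    also have "(\<Sum>v\<in>A - ?V. real m * \<eta> * p v) = real m * \<eta> * sum p (A - ?V)"
      by (simp add: sum_distrib_left)
    also have "sum p (A - ?V) \<le> sum p A"
      by (rule sum_mono2) (use fin pos in \<open>auto intro: less_imp_le\<close>)
    finally show ?thesis using eta by (simp add: mult_left_mono)
  qed
  \<comment> \<open>Unrolling \<open>step\<close> backwards in time raises the level. For
    \<open>l = 0\<close> the left side is all surviving mass, and after \<open>j\<close> steps back
    only the weight of \<open>rich m A j\<close> and the error terms remain.\<close>
  have "sum (a i) (rich m A l) \<le> sum p (rich m A (l + i)) + real i * (real m * \<eta> * sum p A)" for i l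
  proof (induction i arbitrary: l)
    case (Suc i)
    show ?case using step[of i l] Suc[of "Suc l"] by (simp add: algebra_simps)
  qed (simp add: a0)
  from this[of j 0] have "sum (a j) A \<le> sum p (rich m A j) + real j * (real m * \<eta> * sum p A)"
    by simp
  moreover have "sum p (rich m A j) \<le> real (card (rich m A j)) * \<eta>"
    by (rule sum_bounded_above) (use rich_subset small in blast)
  moreover have "real (card (rich m A j)) * \<eta> \<le> real m * \<eta>"
    using few eta by (intro mult_right_mono) auto
  ultimately show ?thesis using mass[of j] by (simp add: algebra_simps)
qed

text \<open>A permutation stands for the full chain of its prefix sets.\<close>

definition on_chain :: "'a list \<Rightarrow> 'a set \<Rightarrow> bool" where
  "on_chain xs v \<longleftrightarrow> set (take (card v) xs) = v"

section \<open>Full chains through given sets\<close>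

lemma on_chain_subset:
  assumes "on_chain xs v" "on_chain xs w" "card v \<le> card w"
  shows "v \<subseteq> w"
  using assms set_take_subset_set_take[of "card v" "card w" xs] unfolding on_chain_def by metis

lemma on_chain_linear:
  assumes "on_chain xs v" "on_chain xs w"
  shows "v \<subset> w \<or> v = w \<or> w \<subset> v"
  using on_chain_subset[OF assms] on_chain_subset[OF assms(2,1)] by (cases "card v \<le> card w") auto

text \<open>A permutation whose chain passes \<open>v\<close> and \<open>w\<close> is an ordering of
  \<open>v\<close>, followed by one of \<open>w - v\<close>, followed by one of
  \<open>\<Omega> - w\<close>.\<close>

lemma card_on_chain2:
  assumes "finite \<Omega>" "v \<subseteq> w" "w \<subseteq> \<Omega>"
  shows "card {xs \<in> permutations_of_set \<Omega>. on_chain xs v \<and> on_chain xs w} =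
    fact (card v) * (fact (card w - card v) * fact (card \<Omega> - card w))"
proof -
  have fin: "finite w" "finite v" using assms finite_subset by metis+
  let ?P = permutations_of_set
  let ?f = "\<lambda>(a, b, c). a @ b @ c"
  let ?D = "?P v \<times> ?P (w - v) \<times> ?P (\<Omega> - w)"
  have len: "length a = card v \<and> length b = card (w - v)" if "(a, b, c) \<in> ?D" for a b c
    using that length_finite_permutations_of_set by auto
  have cw: "card v + card (w - v) = card w"
    using fin assms by (simp add: card_Diff_subset card_mono)
  have inj: "inj_on ?f ?D"
  proof (rule inj_onI)
    fix x y assume "x \<in> ?D" "y \<in> ?D" and eq: "?f x = ?f y"
    moreover obtain a b c a' b' c' where xy: "x = (a, b, c)" "y = (a', b', c')"
      by (metis prod_cases3)
    ultimately have "length a = length a'" "length b = length b'" using len by (metis, metis)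
    then show "x = y" using eq xy by simp
  qed
  have "{xs \<in> ?P \<Omega>. on_chain xs v \<and> on_chain xs w} = ?f ` ?D"
  proof (intro equalityI subsetI)
    fix xs assume "xs \<in> {xs \<in> ?P \<Omega>. on_chain xs v \<and> on_chain xs w}"
    then have xs: "set xs = \<Omega>" "distinct xs" and on: "set (take (card v) xs) = v" "set (take (card w) xs) = w"
      by (auto simp: permutations_of_set_def on_chain_def)
    define b where "b = drop (card v) (take (card w) xs)"
    have vw: "card v \<le> card w" using fin assms by (simp add: card_mono)
    have t: "take (card w) xs = take (card v) xs @ b"
      unfolding b_def by (metis append_take_drop_id min.absorb1 take_take vw)
    have x: "xs = take (card v) xs @ b @ drop (card w) xs"
      using t by (metis append.assoc append_take_drop_id)
    have d1: "set (take (card w) xs) \<inter> set (drop (card w) xs) = {}"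
      using xs(2) set_take_disj_set_drop_if_distinct by blast
    have "distinct (take (card w) xs)" using xs by simp
    then have d2: "set (take (card v) xs) \<inter> set b = {}" "distinct b" unfolding t by auto
    have "set b = w - v" using d2 on t by (metis Diff_triv inf_commute set_append Un_Diff Diff_cancel Un_empty_left)
    moreover have "set (drop (card w) xs) = \<Omega> - w"
      using d1 on xs by (metis Diff_triv Un_Diff Diff_cancel Un_empty_left append_take_drop_id inf_commute set_append)
    ultimately have "(take (card v) xs, b, drop (card w) xs) \<in> ?D"
      using on xs d2 by (auto simp: permutations_of_set_def)
    then show "xs \<in> ?f ` ?D" using x by (intro image_eqI[of _ _ "(take (card v) xs, b, drop (card w) xs)"]) simp_all
  next
    fix xs assume "xs \<in> ?f ` ?D"
    then obtain a b c where abc: "(a, b, c) \<in> ?D" and x: "xs = a @ b @ c" by auto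
    have l: "length a = card v" "length (a @ b) = card w" using len[OF abc] cw by auto
    have "take (card v) xs = a" "take (card w) xs = a @ b" using l x by auto
    then show "xs \<in> {xs \<in> ?P \<Omega>. on_chain xs v \<and> on_chain xs w}"
      using abc x assms unfolding on_chain_def permutations_of_set_def by auto
  qed
  then have "card {xs \<in> ?P \<Omega>. on_chain xs v \<and> on_chain xs w} = card ?D"
    using card_image[OF inj] by simp
  then show ?thesis using assms fin
    by (simp add: card_cartesian_product card_Diff_subset)
qed

lemma card_on_chain:
  assumes "finite \<Omega>" "v \<subseteq> \<Omega>"
  shows "card {xs \<in> permutations_of_set \<Omega>. on_chain xs v} = fact (card v) * fact (card \<Omega> - card v)"
  using card_on_chain2[of \<Omega> "{}" v] assms by (simp add: on_chain_def)

lemma card_on_chain_div: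
  assumes "finite \<Omega>" "v \<subseteq> \<Omega>"
  shows "real (card {xs \<in> permutations_of_set \<Omega>. on_chain xs v}) / fact (card \<Omega>) = 1 / real (card \<Omega> choose card v)"
  using assms by (simp add: card_on_chain binomial_fact card_mono)

text \<open>Makes both the weights and the transition probabilities of the random chain O(1 / n). It
  fails at the two ends, so the empty set and the ground set have to be excluded.\<close>

lemma le_binomial_interior: "0 < b \<Longrightarrow> b < a \<Longrightarrow> a \<le> a choose b"
proof (induction a arbitrary: b)
  case (Suc a)
  then obtain c where c: "b = Suc c" by (cases b) auto
  show ?case
  proof (cases "Suc c = a")
    case True
    then show ?thesis using c by simp
  next
    case False
    then have "a \<le> a choose Suc c" using Suc c by auto
    moreover have "1 \<le> a choose c" using Suc c by (simp add: Suc_le_eq)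
    ultimately show ?thesis unfolding c binomial_Suc_Suc by linarith
  qed
qed simp

lemma sum_card_swap:
  assumes "finite B" "finite X"
  shows "(\<Sum>w\<in>B. real (card {x \<in> X. Q x w})) = (\<Sum>x\<in>X. real (card {w \<in> B. Q x w}))"
proof -
  have "(\<Sum>w\<in>B. real (card {x \<in> X. Q x w})) = (\<Sum>w\<in>B. \<Sum>x\<in>X. of_bool (Q x w))"
    using assms by (simp add: Int_def)
  also have "\<dots> = (\<Sum>x\<in>X. \<Sum>w\<in>B. of_bool (Q x w))" by (rule sum.swap)
  finally show ?thesis using assms by (simp add: Int_def)
qed

text \<open>Double counting of pairs of a permutation and a member on its chain: the sum is the
  expected number of members on a uniformly random full chain. For \<open>l = 1\<close> it gives the
  LYM inequality for antichains.\<close>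

lemma LYM_bound:
  assumes "finite \<Omega>" "A \<subseteq> Pow \<Omega>"
    and chains: "\<And>xs. xs \<in> permutations_of_set \<Omega> \<Longrightarrow> card {v \<in> A. on_chain xs v} \<le> l"
  shows "(\<Sum>v\<in>A. 1 / real (card \<Omega> choose card v)) \<le> real l"
proof -
  let ?P = "permutations_of_set \<Omega>"
  have fA: "finite A" using finite_subset[OF assms(2)] assms(1) by simp
  have "(\<Sum>v\<in>A. 1 / real (card \<Omega> choose card v)) = (\<Sum>v\<in>A. real (card {xs \<in> ?P. on_chain xs v})) / fact (card \<Omega>)"
    unfolding sum_divide_distrib using assms by (intro sum.cong refl card_on_chain_div[symmetric]) auto
  also have "\<dots> = (\<Sum>xs\<in>?P. real (card {v \<in> A. on_chain xs v})) / fact (card \<Omega>)"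
    by (subst sum_card_swap) (use fA in auto)
  also have "\<dots> \<le> (\<Sum>xs\<in>?P. real l) / fact (card \<Omega>)"
    by (intro divide_right_mono sum_mono) (use chains in auto)
  also have "\<dots> = real l" using assms by simp
  finally show ?thesis .
qed

text \<open>Only members of \<open>A\<close> count as lying in between, so the walk jumps from one
  member of \<open>A\<close> on the chain to the next, over any number of levels.\<close>

definition consecutive :: "'a set set \<Rightarrow> 'a list \<Rightarrow> 'a set \<Rightarrow> 'a set \<Rightarrow> bool" where
  "consecutive A xs v w \<longleftrightarrow> on_chain xs v \<and> on_chain xs w \<and> v \<subset> w \<and>
     (\<forall>u\<in>A. on_chain xs u \<longrightarrow> \<not> (v \<subset> u \<and> u \<subset> w))"

lemma consecutive_unique_right:
  assumes "consecutive A xs v w" "consecutive A xs v w'" "w \<in> A" "w' \<in> A"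
  shows "w = w'"
  using assms on_chain_linear[of xs w w'] unfolding consecutive_def by blast

lemma consecutive_unique_left:
  assumes "consecutive A xs v w" "consecutive A xs v' w" "v \<in> A" "v' \<in> A"
  shows "v = v'"
  using assms on_chain_linear[of xs v v'] unfolding consecutive_def by blast

lemma card_le_1I: "(\<And>x y. x \<in> X \<Longrightarrow> y \<in> X \<Longrightarrow> x = y) \<Longrightarrow> card X \<le> 1"
  by (metis One_nat_def card.infinite card_le_Suc0_iff_eq le_SucI le0)

lemma consecutive_exists:
  assumes "\<Union>A \<subseteq> \<Omega>" "finite \<Omega>" "on_chain xs v" "u \<in> A" "on_chain xs u" "v \<subset> u"
  shows "\<exists>w\<in>A. consecutive A xs v w"
proof -
  obtain w where w: "w \<in> A" "on_chain xs w" "v \<subset> w"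
    and least: "\<And>y. y \<in> A \<and> on_chain xs y \<and> v \<subset> y \<Longrightarrow> card w \<le> card y"
    using ex_has_least_nat[of "\<lambda>w. w \<in> A \<and> on_chain xs w \<and> v \<subset> w" u card] assms by blast
  have "finite w" using w assms by (meson Union_upper finite_subset)
  then have "\<not> (v \<subset> y \<and> y \<subset> w)" if "y \<in> A" "on_chain xs y" for y
    using least[of y] that psubset_card_mono[of w y] by (meson leD)
  then show ?thesis using w assms unfolding consecutive_def by blast
qed

text \<open>An instance of \<open>kernel_bound_if_few_rich\<close>: for a uniformly random full
  chain, \<open>p v\<close> is the probability of passing \<open>v\<close>, and \<open>M v w\<close>
  that of passing \<open>v\<close> with \<open>w\<close> as the next member of \<open>A\<close>.
  Then \<open>s\<close> is the expected number of members on the chain, and \<open>\<eta>\<close> is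
  \<open>4 / card \<Omega>\<close>. It is used in contrapositive form: large \<open>s\<close> forces
  many rich sets.\<close>

lemma supersaturation:
  assumes fin: "finite \<Omega>" and A: "A \<subseteq> Pow \<Omega>" and n: "0 < card \<Omega>"
    and mid: "\<And>v. v \<in> A \<Longrightarrow> v \<noteq> {} \<and> 4 * card v \<le> 3 * card \<Omega>"
    and few: "card (rich m A j) < m"
  defines "s \<equiv> \<Sum>v\<in>A. 1 / real (card \<Omega> choose card v)"
  shows "s - real j \<le> real m * (4 / real (card \<Omega>)) * (1 + real j * s)"
proof -
  let ?n = "card \<Omega>" and ?P = "permutations_of_set \<Omega>"
  define p where "p v = 1 / real (?n choose card v)" for v :: "'a set"
  define M where "M v w = real (card {xs \<in> ?P. consecutive A xs v w}) / fact ?n" for v w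
  have fA: "finite A" using A fin finite_subset by auto
  have finv: "finite v" "card v < ?n" "0 < card v" "v \<subseteq> \<Omega>" if "v \<in> A" for v
  proof -
    show sub: "v \<subseteq> \<Omega>" using that A by auto
    then show f: "finite v" using fin finite_subset by blast
    show "card v < ?n" using mid[OF that] n by linarith
    show "0 < card v" using mid[OF that] f by (simp add: card_gt_0_iff)
  qed
  have p: "real (card {xs \<in> ?P. on_chain xs v}) / fact ?n = p v" if "v \<in> A" for v
    unfolding p_def using card_on_chain_div[OF fin] that A by auto
  have fact0: "(0::real) < fact ?n" by simp
  have out: "(\<Sum>w\<in>A. real (card {xs \<in> ?P. consecutive A xs v w})) \<le> real (card {xs \<in> ?P. on_chain xs v})" for v
  proof -
    have "(\<Sum>w\<in>A. real (card {xs \<in> ?P. consecutive A xs v w})) = (\<Sum>xs\<in>?P. real (card {w \<in> A. consecutive A xs v w}))"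
      by (rule sum_card_swap) (use fA in auto)
    also have "\<dots> \<le> (\<Sum>xs\<in>?P. of_bool (on_chain xs v))"
    proof (rule sum_mono)
      fix xs
      show "real (card {w \<in> A. consecutive A xs v w}) \<le> of_bool (on_chain xs v)"
      proof (cases "on_chain xs v")
        case True
        have "card {w \<in> A. consecutive A xs v w} \<le> 1"
          by (rule card_le_1I) (use consecutive_unique_right in blast)
        then show ?thesis using True by simp
      next
        case False
        then have none: "{w \<in> A. consecutive A xs v w} = {}" by (auto simp: consecutive_def)
        show ?thesis unfolding none by simp
      qed
    qed
    finally show ?thesis by (simp add: Int_def)
  qed
  have inn: "(\<Sum>v\<in>A. real (card {xs \<in> ?P. consecutive A xs v w})) \<le> real (card {xs \<in> ?P. on_chain xs w})" for w
  proof -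
    have "(\<Sum>v\<in>A. real (card {xs \<in> ?P. consecutive A xs v w})) = (\<Sum>xs\<in>?P. real (card {v \<in> A. consecutive A xs v w}))"
      by (rule sum_card_swap) (use fA in auto)
    also have "\<dots> \<le> (\<Sum>xs\<in>?P. of_bool (on_chain xs w))"
    proof (rule sum_mono)
      fix xs
      show "real (card {v \<in> A. consecutive A xs v w}) \<le> of_bool (on_chain xs w)"
      proof (cases "on_chain xs w")
        case True
        have "card {v \<in> A. consecutive A xs v w} \<le> 1"
          by (rule card_le_1I) (use consecutive_unique_left in blast)
        then show ?thesis using True by simp
      next
        case False
        then have none: "{v \<in> A. consecutive A xs v w} = {}" by (auto simp: consecutive_def)
        show ?thesis unfolding none by simp
      qed
    qed
    finally show ?thesis by (simp add: Int_def)
  qed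
  \<comment> \<open>The defect at \<open>v\<close> is at most the probability that \<open>v\<close>
    is the last member of \<open>A\<close> on the chain, and a chain has at most one last
    member.\<close>
  have defect: "(\<Sum>v\<in>A. p v - (\<Sum>w\<in>A. M v w)) \<le> 1"
  proof -
    have pM: "p v - (\<Sum>w\<in>A. M v w) \<le> real (card {xs \<in> ?P. on_chain xs v \<and> (\<forall>w\<in>A. \<not> consecutive A xs v w)}) / fact ?n"
      if v: "v \<in> A" for v
    proof -
      let ?X = "{xs \<in> ?P. on_chain xs v \<and> (\<forall>w\<in>A. \<not> consecutive A xs v w)}"
      have "{xs \<in> ?P. on_chain xs v} \<subseteq> ?X \<union> (\<Union>w\<in>A. {xs \<in> ?P. consecutive A xs v w})" by blast
      then have "card {xs \<in> ?P. on_chain xs v} \<le> card (?X \<union> (\<Union>w\<in>A. {xs \<in> ?P. consecutive A xs v w}))"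
        by (intro card_mono) (use fA in auto)
      also have "\<dots> \<le> card ?X + card (\<Union>w\<in>A. {xs \<in> ?P. consecutive A xs v w})" by (rule card_Un_le)
      also have "card (\<Union>w\<in>A. {xs \<in> ?P. consecutive A xs v w}) \<le> (\<Sum>w\<in>A. card {xs \<in> ?P. consecutive A xs v w})"
        by (rule card_UN_le[OF fA])
      finally have "real (card {xs \<in> ?P. on_chain xs v}) \<le> real (card ?X) + (\<Sum>w\<in>A. real (card {xs \<in> ?P. consecutive A xs v w}))"
        by (simp flip: of_nat_sum of_nat_add)
      from divide_right_mono[OF this, of "fact ?n"] show ?thesis
        unfolding p[OF v, symmetric] by (simp add: M_def sum_divide_distrib add_divide_distrib)
    qed
    have "(\<Sum>v\<in>A. p v - (\<Sum>w\<in>A. M v w)) \<le>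
        (\<Sum>v\<in>A. real (card {xs \<in> ?P. on_chain xs v \<and> (\<forall>w\<in>A. \<not> consecutive A xs v w)}) / fact ?n)"
      by (rule sum_mono) (rule pM)
    also have "\<dots> = (\<Sum>xs\<in>?P. real (card {v \<in> A. on_chain xs v \<and> (\<forall>w\<in>A. \<not> consecutive A xs v w)})) / fact ?n"
      unfolding sum_divide_distrib[symmetric] by (subst sum_card_swap) (use fA in auto)
    also have "\<dots> \<le> (\<Sum>xs\<in>?P. 1) / fact ?n"
    proof (intro divide_right_mono sum_mono)
      fix xs
      have "card {v \<in> A. on_chain xs v \<and> (\<forall>w\<in>A. \<not> consecutive A xs v w)} \<le> 1"
      proof (rule card_le_1I)
        fix x y assume x: "x \<in> {v \<in> A. on_chain xs v \<and> (\<forall>w\<in>A. \<not> consecutive A xs v w)}"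
          and y: "y \<in> {v \<in> A. on_chain xs v \<and> (\<forall>w\<in>A. \<not> consecutive A xs v w)}"
        have U: "\<Union>A \<subseteq> \<Omega>" using A by auto
        show "x = y"
          using on_chain_linear[of xs x y] consecutive_exists[OF U fin, of xs x y]
            consecutive_exists[OF U fin, of xs y x] x y by blast
      qed
      then show "real (card {v \<in> A. on_chain xs v \<and> (\<forall>w\<in>A. \<not> consecutive A xs v w)}) \<le> 1" by simp
    qed simp
    also have "\<dots> = 1" using fin by simp
    finally show ?thesis .
  qed
  \<comment> \<open>A chain through \<open>v\<close> passes \<open>w\<close> with probability 1 /
    (\<open>?a\<close> choose \<open>?b\<close>). Here \<open>0 < ?b < ?a\<close> because
    \<open>w\<close> is not the ground set, so this is at most 1 / \<open>?a\<close>; by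
    \<open>mid\<close>, \<open>?a\<close> is at least a quarter of
    \<open>card \<Omega>\<close>.\<close>
  have small: "M v w \<le> 4 / real ?n * p v" if v: "v \<in> A" and w: "w \<in> A" for v w
  proof (cases "v \<subset> w")
    case False
    then have "M v w = 0" by (auto simp: M_def consecutive_def)
    then show ?thesis by (simp add: p_def)
  next
    case True
    have c: "card v < card w" using True finv[OF w] psubset_card_mono by auto
    let ?a = "?n - card v" and ?b = "card w - card v"
    have ab: "0 < ?b" "?b < ?a" "?a - ?b = ?n - card w" using c finv(2)[OF w] by auto
    have "{xs \<in> ?P. consecutive A xs v w} \<subseteq> {xs \<in> ?P. on_chain xs v \<and> on_chain xs w}"
      by (auto simp: consecutive_def)
    then have "card {xs \<in> ?P. consecutive A xs v w} \<le> card {xs \<in> ?P. on_chain xs v \<and> on_chain xs w}"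
      by (intro card_mono) auto
    also have "\<dots> = fact (card v) * (fact ?b * fact (?n - card w))"
      by (rule card_on_chain2[OF fin]) (use True finv(4)[OF w] in auto)
    finally have 1: "real (card {xs \<in> ?P. consecutive A xs v w}) \<le> fact (card v) * (fact ?b * fact (?n - card w))"
      by (simp only: of_nat_le_iff[where 'a = real, symmetric] of_nat_mult of_nat_fact)
    have "?a * (fact ?b * fact (?a - ?b)) \<le> (?a choose ?b) * (fact ?b * fact (?a - ?b))"
      using le_binomial_interior[OF ab(1,2)] by (rule mult_le_mono1)
    also have "\<dots> = fact ?a"
      using binomial_fact_lemma[of ?b ?a] ab(2) by (simp add: mult_ac)
    finally have "real ?a * (fact ?b * fact (?a - ?b)) \<le> (fact ?a :: real)"
      by (simp only: of_nat_le_iff[where 'a = real, symmetric] of_nat_mult of_nat_fact)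
    then have 2: "real ?a * (fact ?b * fact (?n - card w)) \<le> (fact ?a :: real)" using ab by simp
    have "real ?n \<le> 4 * real ?a" using mid[OF v] by linarith
    then have "real ?n * (fact ?b * fact (?n - card w)) \<le> 4 * real ?a * (fact ?b * fact (?n - card w))"
      by (intro mult_right_mono) auto
    then have "real ?n * (fact ?b * fact (?n - card w)) \<le> 4 * fact ?a" using 2 by linarith
    then have 3: "fact (card v) * (real ?n * (fact ?b * fact (?n - card w))) \<le> fact (card v) * (4 * fact ?a :: real)"
      by (intro mult_left_mono) auto
    have "real ?n * real (card {xs \<in> ?P. consecutive A xs v w}) \<le> real ?n * (fact (card v) * (fact ?b * fact (?n - card w)))"
      using 1 by (intro mult_left_mono) auto
    also have "\<dots> = fact (card v) * (real ?n * (fact ?b * fact (?n - card w)))"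
      by (rule mult.left_commute)
    also note 3
    also have "fact (card v) * (4 * fact ?a) = 4 * (fact (card v) * fact ?a :: real)"
      by (rule mult.left_commute)
    also have "fact (card v) * fact ?a = real (card {xs \<in> ?P. on_chain xs v})"
      using card_on_chain[OF fin finv(4)[OF v]] by simp
    also have "\<dots> = p v * fact ?n" using p[OF v] by (simp add: field_simps)
    finally show ?thesis using n by (simp add: M_def field_simps)
  qed
  have p_small: "p v \<le> 4 / real ?n" if v: "v \<in> A" for v
  proof -
    have "real ?n \<le> real (?n choose card v)" using le_binomial_interior finv[OF v] by simp
    then have "p v \<le> 1 / real ?n" unfolding p_def using n by (intro frac_le) auto
    also have "\<dots> \<le> 4 / real ?n" by (simp add: divide_right_mono)
    finally show ?thesis .
  qed
  have "sum p A - real j \<le> real m * (4 / real ?n) * (1 + real j * sum p A)"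
  proof (rule kernel_bound_if_few_rich[OF fA, where M = M])
    show "0 \<le> M v w" for v w by (simp add: M_def)
    show "v \<subset> w" if "M v w \<noteq> 0" for v w
      using that by (force simp: M_def consecutive_def)
    show "0 < p v" if "v \<in> A" for v using finv(2)[OF that] by (simp add: p_def)
    show "(\<Sum>w\<in>A. M v w) \<le> p v" if "v \<in> A" for v
      using divide_right_mono[OF out[of v], of "fact ?n"] p[OF that] by (simp add: M_def sum_divide_distrib)
    show "(\<Sum>v\<in>A. M v w) \<le> p w" if "w \<in> A" for w
      using divide_right_mono[OF inn[of w], of "fact ?n"] p[OF that] by (simp add: M_def sum_divide_distrib)
  qed (use defect small p_small few in auto)
  then show ?thesis by (simp add: s_def p_def)
qed

section \<open>Embedding tree posets\<close>

text \<open>Take a position \<open>i\<close> and an entry \<open>c ! i\<close> with few partners at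
  position \<open>j\<close>, put all these pairs into \<open>E\<close>, and drop all chains with
  this entry at \<open>i\<close>; they are now hit. The potential is the number of triples
  \<open>(i, j, d ! i)\<close> that occur: each round costs at most \<open>p\<close> pairs and
  destroys a triple.\<close>

lemma peeling:
  fixes H :: "'a list set"
  assumes "finite H"
    and "\<And>H'. H' \<subseteq> H \<Longrightarrow> H' \<noteq> {} \<Longrightarrow>
      \<exists>c\<in>H'. \<exists>i<k. \<exists>j<k. i \<noteq> j \<and> card ((\<lambda>d. d ! j) ` {d \<in> H'. d ! i = c ! i}) \<le> p"
  shows "\<exists>E. finite E \<and> (\<forall>(v, w)\<in>E. \<exists>d\<in>H. \<exists>i<k. \<exists>j<k. i \<noteq> j \<and> v = d ! i \<and> w = d ! j) \<and>
      (\<forall>d\<in>H. \<exists>i<k. \<exists>j<k. (d ! i, d ! j) \<in> E) \<and>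
      card E \<le> p * card (\<Union>d\<in>H. (\<lambda>(i, j). (i, j, d ! i)) ` ({..<k} \<times> {..<k}))"
  using assms
proof (induction "card H" arbitrary: H rule: less_induct)
  case less
  let ?K = "\<lambda>H. \<Union>d\<in>H. (\<lambda>(i, j). (i, j, d ! i)) ` ({..<k} \<times> {..<k})"
  show ?case
  proof (cases "H = {}")
    case True
    then show ?thesis by (intro exI[of _ "{}"]) simp
  next
    case False
    then obtain c i j where c: "c \<in> H" "i < k" "j < k" "i \<noteq> j"
      and few: "card ((\<lambda>d. d ! j) ` {d \<in> H. d ! i = c ! i}) \<le> p"
      using less.prems(2)[of H] by blast
    define H' where "H' = {d \<in> H. d ! i \<noteq> c ! i}"
    have H': "H' \<subset> H" using c by (auto simp: H'_def)
    have fin: "finite H'" using H' less.prems(1) by (meson finite_subset psubsetE)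
    have "card H' < card H" using H' less.prems(1) by (simp add: psubset_card_mono)
    from less.hyps[OF this fin] less.prems(2) H'
    obtain E where E: "finite E" "\<forall>(v, w)\<in>E. \<exists>d\<in>H'. \<exists>i<k. \<exists>j<k. i \<noteq> j \<and> v = d ! i \<and> w = d ! j"
      "\<forall>d\<in>H'. \<exists>i<k. \<exists>j<k. (d ! i, d ! j) \<in> E" "card E \<le> p * card (?K H')"
      by (smt (verit) psubset_imp_subset subset_trans)
    define D where "D = (\<lambda>d. (c ! i, d ! j)) ` {d \<in> H. d ! i = c ! i}"
    have "D = Pair (c ! i) ` (\<lambda>d. d ! j) ` {d \<in> H. d ! i = c ! i}" by (auto simp: D_def)
    then have "card D \<le> card ((\<lambda>d. d ! j) ` {d \<in> H. d ! i = c ! i})"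
      using less.prems(1) by (simp add: card_image_le)
    then have D: "card D \<le> p" using few by simp
    have fD: "finite D" using less.prems(1) by (simp add: D_def)
    have "insert (i, j, c ! i) (?K H') \<subseteq> ?K H" using c by (auto simp: H'_def)
    moreover have "finite (?K H)" using less.prems(1) by auto
    ultimately have "card (insert (i, j, c ! i) (?K H')) \<le> card (?K H)" by (rule card_mono[rotated])
    \<comment> \<open>No remaining chain has \<open>c ! i\<close> at position \<open>i\<close>, so
      the triple is gone for good.\<close>
    moreover have "(i, j, c ! i) \<notin> ?K H'" by (auto simp: H'_def)
    moreover have "finite (?K H')" using fin by auto
    ultimately have "Suc (card (?K H')) \<le> card (?K H)" by simp
    then have "p * Suc (card (?K H')) \<le> p * card (?K H)" by (rule mult_le_mono2)
    moreover have "card (E \<union> D) \<le> card E + card D" by (rule card_Un_le)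
    ultimately have "card (E \<union> D) \<le> p * card (?K H)" using E(4) D by simp
    moreover have "\<exists>d\<in>H. \<exists>i<k. \<exists>j<k. i \<noteq> j \<and> v = d ! i \<and> w = d ! j" if "(v, w) \<in> E \<union> D" for v w
    proof (cases "(v, w) \<in> E")
      case True
      then show ?thesis using E(2) H' by blast
    next
      case False
      then have "(v, w) \<in> D" using that by blast
      then obtain d where "d \<in> H" "d ! i = c ! i" "(v, w) = (c ! i, d ! j)" unfolding D_def by blast
      then show ?thesis using c by (metis prod.inject)
    qed
    moreover have "\<exists>i<k. \<exists>j<k. (d ! i, d ! j) \<in> E \<union> D" if "d \<in> H" for d
    proof (cases "d \<in> H'")
      case True
      then show ?thesis using E(3) by blast
    next
      case False
      then have "(d ! i, d ! j) \<in> D" using that by (auto simp: D_def H'_def)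
      then show ?thesis using c by blast
    qed
    ultimately show ?thesis using E(1) fD by (intro exI[of _ "E \<union> D"]) auto
  qed
qed

text \<open>The size of a longest chain strictly below \<open>x\<close>. It serves as the position
  of \<open>x\<close> in a \<open>k\<close>-chain: strictly monotone and below the height. The empty
  chain keeps the maximum well defined.\<close>

definition poset_rank :: "'a rel \<Rightarrow> 'a \<Rightarrow> nat" where
  "poset_rank P x = Max (card ` {C \<in> Chains P. \<forall>z\<in>C. poset_less P z x})"

lemma poset_less_Field: "poset_less P x y \<Longrightarrow> x \<in> Field P \<and> y \<in> Field P"
  by (auto simp: poset_less_def Field_def)

lemma Chains_subset_Pow: "Chains P \<subseteq> Pow (Field P)"
  by (auto simp: Chains_def Field_def)

section \<open>Ranks and height of a fixed finite poset\<close>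

context
  fixes P :: "'a rel"
  assumes fin: "finite (Field P)" and po: "Partial_order P"
begin

lemma poset_less_trans: "poset_less P x y \<Longrightarrow> poset_less P y z \<Longrightarrow> poset_less P x z"
  using po unfolding poset_less_def partial_order_on_def preorder_on_def
  by (metis antisymD transD)

lemma finite_Chains: "finite (Chains P)"
  using Chains_subset_Pow[of P] fin finite_subset by blast

lemma poset_rank_attained:
  obtains C where "C \<in> Chains P" "\<forall>z\<in>C. poset_less P z x" "card C = poset_rank P x"
proof -
  have "{} \<in> {C \<in> Chains P. \<forall>z\<in>C. poset_less P z x}" by (simp add: Chains_def)
  then have "poset_rank P x \<in> card ` {C \<in> Chains P. \<forall>z\<in>C. poset_less P z x}"
    unfolding poset_rank_def by (intro Max_in) (use finite_Chains in auto)
  then show ?thesis using that by auto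
qed

lemma insert_Chains:
  assumes "C \<in> Chains P" "\<forall>z\<in>C. poset_less P z x" "x \<in> Field P"
  shows "insert x C \<in> Chains P" "card (insert x C) = Suc (card C)"
proof -
  have "(x, x) \<in> P" using po assms(3) by (auto simp: partial_order_on_def preorder_on_def refl_on_def)
  then show "insert x C \<in> Chains P" using assms by (auto simp: Chains_def poset_less_def)
  have "finite C" using assms(1) Chains_subset_Pow fin finite_subset by blast
  moreover have "x \<notin> C" using assms(2) by (auto simp: poset_less_def)
  ultimately show "card (insert x C) = Suc (card C)" by simp
qed

lemma poset_rank_mono:
  assumes "poset_less P x y"
  shows "poset_rank P x < poset_rank P y"
proof -
  obtain C where C: "C \<in> Chains P" "\<forall>z\<in>C. poset_less P z x" "card C = poset_rank P x"
    by (rule poset_rank_attained)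
  have "\<forall>z\<in>insert x C. poset_less P z y" using C assms poset_less_trans by blast
  moreover have "insert x C \<in> Chains P"
    by (rule insert_Chains) (use C poset_less_Field[OF assms] in auto)
  ultimately have "card (insert x C) \<le> poset_rank P y"
    unfolding poset_rank_def by (intro Max_ge) (use finite_Chains in auto)
  then show ?thesis using insert_Chains[OF C(1,2)] C(3) poset_less_Field[OF assms] by simp
qed

lemma poset_rank_less_height:
  assumes "x \<in> Field P"
  shows "poset_rank P x < poset_height P"
proof -
  obtain C where C: "C \<in> Chains P" "\<forall>z\<in>C. poset_less P z x" "card C = poset_rank P x"
    by (rule poset_rank_attained)
  have "card (insert x C) \<le> poset_height P"
    unfolding poset_height_def using insert_Chains(1)[OF C(1,2) assms] finite_Chains by (intro Max_ge) auto
  then show ?thesis using insert_Chains[OF C(1,2) assms] C(3) by simp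
qed

lemma poset_height_attained:
  obtains C where "C \<in> Chains P" "card C = poset_height P"
proof -
  have "{} \<in> Chains P" by (simp add: Chains_def)
  then have "poset_height P \<in> card ` Chains P"
    unfolding poset_height_def by (intro Max_in) (use finite_Chains in auto)
  then show ?thesis using that by auto
qed

text \<open>A relation that is neither trivial nor a cover has an element strictly in between, and
  both halves have a smaller rank difference.\<close>

lemma mono_if_mono_on_covers:
  fixes f :: "'a \<Rightarrow> 'b::order"
  assumes "\<And>x y. covers P y x \<Longrightarrow> f x \<le> f y" "(x, y) \<in> P"
  shows "f x \<le> f y"
  using assms(2)
proof (induction "poset_rank P y - poset_rank P x" arbitrary: x y rule: less_induct)
  case less
  show ?case
  proof (cases "x = y \<or> covers P y x")
    case True
    then show ?thesis using assms(1) by auto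
  next
    case False
    then have "poset_less P x y" using less.prems by (simp add: poset_less_def)
    then obtain z where z: "poset_less P x z" "poset_less P z y"
      using False unfolding covers_def by blast
    then have r: "poset_rank P x < poset_rank P z" "poset_rank P z < poset_rank P y"
      using poset_rank_mono by auto
    have "f x \<le> f z" by (rule less.hyps) (use r z in \<open>auto simp: poset_less_def\<close>)
    also have "f z \<le> f y" by (rule less.hyps) (use r z in \<open>auto simp: poset_less_def\<close>)
    finally show ?thesis .
  qed
qed

end

section \<open>Attaching a vertex to a connected part of a tree\<close>

lemma rtrancl_leaves_set:
  assumes "(a, b) \<in> R\<^sup>*" "a \<in> S" "b \<notin> S"
  shows "\<exists>x y. x \<in> S \<and> y \<notin> S \<and> (x, y) \<in> R"
  using assms by (induction rule: rtrancl_induct) blast+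

text \<open>Simple paths inside \<open>S\<close> instead of a reachability relation, because
  \<open>graph_cycle\<close> needs a list of distinct vertices.\<close>

definition joined :: "'a rel \<Rightarrow> 'a set \<Rightarrow> 'a \<Rightarrow> 'a \<Rightarrow> bool" where
  "joined E S x y \<longleftrightarrow> (\<exists>l. l \<noteq> [] \<and> hd l = x \<and> last l = y \<and> distinct l \<and> set l \<subseteq> S \<and>
     successively (\<lambda>u v. (u, v) \<in> E) l)"

lemma joined_sym:
  assumes "joined E S x y" "sym E"
  shows "joined E S y x"
proof -
  obtain l where l: "l \<noteq> []" "hd l = x" "last l = y" "distinct l" "set l \<subseteq> S"
     "successively (\<lambda>u v. (u, v) \<in> E) l"
    using assms(1) by (auto simp: joined_def)
  have eq: "(\<lambda>x y. (y, x) \<in> E) = (\<lambda>x y. (x, y) \<in> E)" using assms(2) by (auto simp: sym_def fun_eq_iff)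
  have "successively (\<lambda>x y. (y, x) \<in> E) l" using l(6) by (simp only: eq)
  then show ?thesis unfolding joined_def using l
    by (intro exI[of _ "rev l"]) (simp add: hd_rev last_rev)
qed

lemma joined_extend:
  assumes "joined E S x z" "(y, x) \<in> E" "y \<notin> S"
  shows "joined E (insert y S) y z"
proof -
  obtain l where l: "l \<noteq> []" "hd l = x" "last l = z" "distinct l" "set l \<subseteq> S"
     "successively (\<lambda>u v. (u, v) \<in> E) l"
    using assms(1) by (auto simp: joined_def)
  then show ?thesis unfolding joined_def using assms(2,3)
    by (intro exI[of _ "y # l"]) (auto simp: successively_Cons)
qed

lemma joined_mono: "joined E S x y \<Longrightarrow> S \<subseteq> T \<Longrightarrow> joined E T x y"
  unfolding joined_def by (elim ex_forward) auto

text \<open>Two different neighbours of \<open>y\<close> in a connected \<open>S\<close> would be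
  joined by a path avoiding \<open>y\<close>, which \<open>y\<close> closes to a cycle.\<close>

lemma unique_attachment:
  assumes "\<not> (\<exists>c. graph_cycle E c)" "sym E" "joined E S x x'" "y \<notin> S" "(x, y) \<in> E" "(x', y) \<in> E"
  shows "x = x'"
proof (rule ccontr)
  assume "x \<noteq> x'"
  obtain l where l: "l \<noteq> []" "hd l = x" "last l = x'" "distinct l" "set l \<subseteq> S"
     "successively (\<lambda>u v. (u, v) \<in> E) l"
    using assms(3) by (auto simp: joined_def)
  have "2 \<le> length l"
    using l(1-3) \<open>x \<noteq> x'\<close> by (cases l; cases "tl l") auto
  moreover have "(y, x) \<in> E" using assms by (auto dest: symD)
  ultimately have "graph_cycle E (y # l)"
    unfolding graph_cycle_def using l assms by (auto simp: successively_Cons)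
  then show False using assms(1) by blast
qed

text \<open>A connected part of the tree grows by one vertex \<open>y\<close> at a time. Its only
  neighbour \<open>x\<close> in that part sits at position \<open>r x\<close> of some chain of
  \<open>H\<close>; richness offers at least \<open>card (Field P)\<close> values at position
  \<open>r y\<close> of chains with the same entry at \<open>r x\<close>, and fewer are occupied.
  The only new cover relation is the one between \<open>x\<close> and \<open>y\<close>, and it holds
  because both values lie on one chain.\<close>

lemma tree_embeds_in_rich_chains:
  fixes P :: "'a rel" and H :: "'b::order list set"
  assumes tree: "tree_poset P"
    and r: "\<And>x y. poset_less P x y \<Longrightarrow> r x < r y" "\<And>x. x \<in> Field P \<Longrightarrow> r x < k"
    and H: "H \<noteq> {}" "\<And>c. c \<in> H \<Longrightarrow> length c = k \<and> sorted_wrt (<) c" "finite H"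
    and rich: "\<And>c i j. c \<in> H \<Longrightarrow> i < k \<Longrightarrow> j < k \<Longrightarrow> i \<noteq> j \<Longrightarrow>
      card (Field P) \<le> card ((\<lambda>d. d ! j) ` {d \<in> H. d ! i = c ! i})"
  obtains \<phi> where "inj_on \<phi> (Field P)" "\<phi> ` Field P \<subseteq> (\<Union>c\<in>H. set c)" "\<And>x y. (x, y) \<in> P \<Longrightarrow> \<phi> x \<le> \<phi> y"
proof -
  let ?V = "Field P" and ?E = "hasse_edges P"
  have fin: "finite ?V" and po: "Partial_order P" and ne: "?V \<noteq> {}"
    and conn: "\<And>x y. x \<in> ?V \<Longrightarrow> y \<in> ?V \<Longrightarrow> (x, y) \<in> ?E\<^sup>*" and acyc: "\<not> (\<exists>c. graph_cycle ?E c)"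
    using tree by (auto simp: tree_poset_def graph_tree_def)
  have symE: "sym ?E" by (auto simp: sym_def hasse_edges_def)
  have EV: "x \<in> ?V \<and> y \<in> ?V" if "(x, y) \<in> ?E" for x y
    using that poset_less_Field by (force simp: hasse_edges_def covers_def)
  define good where "good S \<phi> \<longleftrightarrow> S \<subseteq> ?V \<and> inj_on \<phi> S \<and> (\<forall>x\<in>S. \<exists>c\<in>H. c ! r x = \<phi> x) \<and>
     (\<forall>x\<in>S. \<forall>y\<in>S. covers P y x \<longrightarrow> \<phi> x \<le> \<phi> y) \<and> (\<forall>x\<in>S. \<forall>y\<in>S. joined ?E S x y)" for S \<phi>
  have "\<exists>S \<phi>. card S = Suc s \<and> good S \<phi>" if "Suc s \<le> card ?V" for s
    using that
  proof (induction s)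
    case 0
    obtain x c where x: "x \<in> ?V" and c: "c \<in> H" using ne H by blast
    have "joined ?E {x} x x" unfolding joined_def by (intro exI[of _ "[x]"]) simp
    then have "good {x} (\<lambda>_. c ! r x)" using x c by (auto simp: good_def)
    then show ?case by (intro exI[of _ "{x}"]) auto
  next
    case (Suc s)
    then obtain S \<phi> where S: "card S = Suc s" and g: "good S \<phi>" by auto
    have SV: "S \<subseteq> ?V" and inj: "inj_on \<phi> S" and role: "\<And>x. x \<in> S \<Longrightarrow> \<exists>c\<in>H. c ! r x = \<phi> x"
      and cov: "\<And>x y. x \<in> S \<Longrightarrow> y \<in> S \<Longrightarrow> covers P y x \<Longrightarrow> \<phi> x \<le> \<phi> y"
      and join: "\<And>x y. x \<in> S \<Longrightarrow> y \<in> S \<Longrightarrow> joined ?E S x y"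
      using g by (auto simp: good_def)
    have finS: "finite S" using SV fin finite_subset by auto
    have "S \<noteq> {}" using S by auto
    then obtain a where a: "a \<in> S" by blast
    have "\<not> ?V \<subseteq> S" using card_mono[OF finS, of ?V] S Suc.prems by auto
    then obtain b where "b \<in> ?V" "b \<notin> S" by blast
    with a obtain x y where x: "x \<in> S" and y: "y \<notin> S" and xy: "(x, y) \<in> ?E"
      using rtrancl_leaves_set[OF conn] SV by blast
    have yV: "y \<in> ?V" using EV[OF xy] by simp
    have only: "x' = x" if "x' \<in> S" "(x', y) \<in> ?E" for x'
      using unique_attachment[OF acyc symE join[OF x that(1)] y xy that(2)] by simp
    obtain c where c: "c \<in> H" "c ! r x = \<phi> x" using role x by auto
    have rk: "r x < k" "r y < k" "r x \<noteq> r y"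
      using r(2) x yV SV xy r(1) by (fastforce simp: hasse_edges_def covers_def)+
    let ?N = "(\<lambda>d. d ! r y) ` {d \<in> H. d ! r x = \<phi> x}"
    have "card (\<phi> ` S) < card ?V" using card_image[OF inj] S Suc.prems by simp
    also have "\<dots> \<le> card ?N" using rich[OF c(1) rk] c by simp
    finally have "\<not> ?N \<subseteq> \<phi> ` S" using finS by (meson card_mono finite_imageI not_le)
    then obtain d where d: "d \<in> H" "d ! r x = \<phi> x" "d ! r y \<notin> \<phi> ` S" by auto
    define \<psi> where "\<psi> = \<phi>(y := d ! r y)"
    have eq: "\<psi> z = \<phi> z" if "z \<in> S" for z using that y by (auto simp: \<psi>_def)
    have d_less: "d ! i \<le> d ! j" if "i < j" "j < k" for i j
      using H(2)[OF d(1)] that by (auto intro!: less_imp_le sorted_wrt_nth_less)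
    have "good (insert y S) \<psi>"
      unfolding good_def
    proof (intro conjI ballI impI)
      show "insert y S \<subseteq> ?V" using SV yV by simp
      have "inj_on \<psi> S" using inj eq by (simp add: inj_on_def)
      moreover have "\<psi> y \<notin> \<psi> ` S" using d(3) eq by (auto simp: \<psi>_def)
      ultimately show "inj_on \<psi> (insert y S)" using y by simp
    next
      fix z assume "z \<in> insert y S"
      then show "\<exists>c\<in>H. c ! r z = \<psi> z" using role eq d by (auto simp: \<psi>_def)
    next
      fix u v assume u: "u \<in> insert y S" and v: "v \<in> insert y S" and c: "covers P v u"
      have uv: "(u, v) \<in> ?E" "(v, u) \<in> ?E" "r u < r v"
        using c r(1) by (auto simp: hasse_edges_def covers_def)
      consider "u \<in> S" "v \<in> S" | "u = y" "v \<in> S" | "v = y" "u \<in> S" | "u = y" "v = y" using u v by auto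
      then show "\<psi> u \<le> \<psi> v"
      proof cases
        case 1
        then show ?thesis using cov c eq by simp
      next
        case 2
        then have "v = x" using only uv by auto
        then show ?thesis using 2 d d_less[of "r y" "r x"] uv rk eq by (simp add: \<psi>_def)
      next
        case 3
        then have "u = x" using only uv by auto
        then show ?thesis using 3 d d_less[of "r x" "r y"] uv rk eq by (simp add: \<psi>_def)
      qed (use uv in auto)
    next
      fix u v assume u: "u \<in> insert y S" and v: "v \<in> insert y S"
      have yx: "(y, x) \<in> ?E" using xy symE by (auto dest: symD)
      have to: "joined ?E (insert y S) y z" if "z \<in> S" for z
        using joined_extend[OF join[OF x that] yx y] .
      have yy: "joined ?E (insert y S) y y" unfolding joined_def by (intro exI[of _ "[y]"]) simp
      consider "u \<in> S" "v \<in> S" | "u = y" "v \<in> S" | "v = y" "u \<in> S" | "u = y" "v = y" using u v by auto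
      then show "joined ?E (insert y S) u v"
        by cases (use joined_mono[OF join] to yy joined_sym[OF to symE] in blast)+
    qed
    moreover have "card (insert y S) = Suc (Suc s)" using S y finS by simp
    ultimately show ?case by blast
  qed
  from this[of "card ?V - 1"] obtain S \<phi> where "card S = card ?V" and g: "good S \<phi>"
    using ne fin by (auto simp: card_gt_0_iff)
  then have S: "S = ?V" using fin by (simp add: card_subset_eq good_def)
  show ?thesis
  proof (rule that[of \<phi>])
    show "inj_on \<phi> ?V" using g S by (simp add: good_def)
    show "\<phi> ` ?V \<subseteq> (\<Union>c\<in>H. set c)"
    proof (rule image_subsetI)
      fix x assume x: "x \<in> ?V"
      then obtain c where c: "c \<in> H" "c ! r x = \<phi> x" using g S by (auto simp: good_def)
      have "c ! r x \<in> set c" by (rule nth_mem) (use H(2)[OF c(1)] r(2)[OF x] in simp)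
      with c show "\<phi> x \<in> (\<Union>c\<in>H. set c)" by auto
    qed
    show "\<phi> x \<le> \<phi> y" if "(x, y) \<in> P" for x y
    proof (rule mono_if_mono_on_covers[OF fin po _ that])
      fix x y assume c: "covers P y x"
      then have "x \<in> ?V" "y \<in> ?V" using poset_less_Field by (force simp: covers_def)+
      then show "\<phi> x \<le> \<phi> y" using g S c by (auto simp: good_def)
    qed
  qed
qed

section \<open>The number of P-free families\<close>

lemma Field_inclusion_order [simp]: "Field (inclusion_order F) = F"
  by (auto simp: inclusion_order_def relation_of_def Field_def)

lemma poset_containsI:
  assumes "inj_on \<phi> (Field P)" "\<phi> ` Field P \<subseteq> F" "\<And>x y. (x, y) \<in> P \<Longrightarrow> \<phi> x \<subseteq> \<phi> y"
  shows "poset_contains (inclusion_order F) P"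
  unfolding poset_contains_def
proof (intro exI[of _ \<phi>] conjI allI impI)
  fix x y assume "(x, y) \<in> P"
  then have "x \<in> Field P" "y \<in> Field P" "\<phi> x \<subseteq> \<phi> y" using assms(3) by (auto simp: Field_def)
  then show "(\<phi> x, \<phi> y) \<in> inclusion_order F"
    using assms(2) by (auto simp: inclusion_order_def relation_of_def)
qed (use assms in auto)

lemma poset_contains_mono:
  assumes "poset_contains (inclusion_order F) P" "F \<subseteq> G"
  shows "poset_contains (inclusion_order G) P"
proof -
  obtain \<phi> where \<phi>: "inj_on \<phi> (Field P)" "\<phi> ` Field P \<subseteq> F"
    "\<forall>A B. (A, B) \<in> P \<longrightarrow> (\<phi> A, \<phi> B) \<in> inclusion_order F"
    using assms(1) unfolding poset_contains_def by auto
  show ?thesis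
    by (rule poset_containsI[of \<phi>]) (use \<phi> assms(2) in \<open>auto simp: inclusion_order_def relation_of_def\<close>)
qed

text \<open>If some nonempty set of \<open>k\<close>-chains had no poor position, \<open>P\<close>
  would embed into \<open>F\<close>. So \<open>peeling\<close> applies to all
  \<open>k\<close>-chains, with at most \<open>k * k * card F\<close> triples.\<close>

lemma poset_free_hitting_pairs:
  fixes F :: "'b set set" and P :: "'a rel"
  assumes tree: "tree_poset P" and free: "poset_free P (inclusion_order F)" and fin: "finite F"
  defines "k \<equiv> poset_height P" and "p \<equiv> card (Field P)"
  obtains E where "finite E" "irrefl E" "E \<subseteq> F \<times> F" "card E \<le> p * (k * k * card F)"
    "\<forall>c. length c = k \<and> sorted_wrt (<) c \<and> set c \<subseteq> F \<longrightarrow> (\<exists>v\<in>set c. \<exists>w\<in>set c. (v, w) \<in> E)"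
proof -
  have finP: "finite (Field P)" and po: "Partial_order P" using tree by (auto simp: tree_poset_def)
  define H where "H = {c. length c = k \<and> sorted_wrt (<) c \<and> set c \<subseteq> F}"
  have "finite {c. set c \<subseteq> F \<and> length c = k}" using fin by (rule finite_lists_length_eq)
  then have finH: "finite H" by (rule rev_finite_subset) (auto simp: H_def)
  have "\<exists>c\<in>H'. \<exists>i<k. \<exists>j<k. i \<noteq> j \<and> card ((\<lambda>d. d ! j) ` {d \<in> H'. d ! i = c ! i}) \<le> p"
    if H': "H' \<subseteq> H" "H' \<noteq> {}" for H'
  proof (rule ccontr)
    assume "\<not> ?thesis"
    then have rich: "p \<le> card ((\<lambda>d. d ! j) ` {d \<in> H'. d ! i = c ! i})"
      if "c \<in> H'" "i < k" "j < k" "i \<noteq> j" for c i j using that by (meson not_le less_imp_le)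
    obtain \<phi> where \<phi>: "inj_on \<phi> (Field P)" "\<phi> ` Field P \<subseteq> (\<Union>c\<in>H'. set c)" "\<And>x y. (x, y) \<in> P \<Longrightarrow> \<phi> x \<le> \<phi> y"
    proof (rule tree_embeds_in_rich_chains[OF tree, of "poset_rank P" k H'])
      show "poset_rank P x < poset_rank P y" if "poset_less P x y" for x y
        using poset_rank_mono[OF finP po that] .
      show "poset_rank P x < k" if "x \<in> Field P" for x
        using poset_rank_less_height[OF finP po that] by (simp add: k_def)
      show "finite H'" using H' finH finite_subset by auto
      show "length c = k \<and> sorted_wrt (<) c" if "c \<in> H'" for c using that H' by (auto simp: H_def)
    qed (use H' rich p_def in auto)
    have "(\<Union>c\<in>H'. set c) \<subseteq> F" using H' by (auto simp: H_def)
    then have "poset_contains (inclusion_order F) P"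
      by (intro poset_containsI[of \<phi>]) (use \<phi> in auto)
    then show False using free by simp
  qed
  from peeling[OF finH this]
  obtain E where E: "finite E" "\<forall>(v, w)\<in>E. \<exists>d\<in>H. \<exists>i<k. \<exists>j<k. i \<noteq> j \<and> v = d ! i \<and> w = d ! j"
      "\<forall>d\<in>H. \<exists>i<k. \<exists>j<k. (d ! i, d ! j) \<in> E"
      "card E \<le> p * card (\<Union>d\<in>H. (\<lambda>(i, j). (i, j, d ! i)) ` ({..<k} \<times> {..<k}))" (is "_ \<le> _ * card ?K")
    by blast
  show ?thesis
  proof (rule that[OF E(1)])
    show "irrefl E"
    proof (rule irreflI, rule notI)
      fix v assume "(v, v) \<in> E"
      then obtain d i j where d: "d \<in> H" "i < k" "j < k" "i \<noteq> j" "d ! i = d ! j" using E(2) by fastforce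
      then have "d ! i < d ! j \<or> d ! j < d ! i"
        by (metis (mono_tags, lifting) H_def linorder_neqE_nat mem_Collect_eq sorted_wrt_nth_less)
      then show False using d by simp
    qed
    show "E \<subseteq> F \<times> F"
    proof
      fix e assume e: "e \<in> E"
      obtain v w where vw: "e = (v, w)" by force
      then obtain d i j where d: "d \<in> H" "i < k" "j < k" "v = d ! i" "w = d ! j" using E(2) e by fastforce
      then have "v \<in> set d" "w \<in> set d" "set d \<subseteq> F" by (auto simp: H_def)
      then show "e \<in> F \<times> F" using vw by auto
    qed
    have "?K \<subseteq> {..<k} \<times> {..<k} \<times> F" by (auto simp: H_def)
    then have "card ?K \<le> card ({..<k} \<times> {..<k} \<times> F)" by (rule card_mono[rotated]) (use fin in auto)
    then have "p * card ?K \<le> p * (k * k * card F)" by (intro mult_le_mono2) (simp add: card_cartesian_product mult_ac)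
    then show "card E \<le> p * (k * k * card F)" using E(4) by linarith
    show "\<forall>c. length c = k \<and> sorted_wrt (<) c \<and> set c \<subseteq> F \<longrightarrow> (\<exists>v\<in>set c. \<exists>w\<in>set c. (v, w) \<in> E)"
    proof (intro allI impI)
      fix c assume c: "length c = k \<and> sorted_wrt (<) c \<and> set c \<subseteq> F"
      then have "c \<in> H" by (simp add: H_def)
      then obtain i j where "i < k" "j < k" "(c ! i, c ! j) \<in> E" using E(3) by blast
      then show "\<exists>v\<in>set c. \<exists>w\<in>set c. (v, w) \<in> E" using c by (metis nth_mem)
    qed
  qed
qed

text \<open>Markov's inequality for the out-degrees, whose sum is \<open>card E\<close>.\<close>

lemma card_high_degree:
  assumes "finite V" "finite E" "E \<subseteq> V \<times> V"
  shows "card {v \<in> V. L < card {w \<in> V. (v, w) \<in> E}} * L \<le> card E"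
proof -
  let ?D = "{v \<in> V. L < card {w \<in> V. (v, w) \<in> E}}"
  have "card ?D * L = (\<Sum>v\<in>?D. L)" by simp
  also have "\<dots> \<le> (\<Sum>v\<in>?D. card {w \<in> V. (v, w) \<in> E})" by (rule sum_mono) auto
  also have "\<dots> \<le> (\<Sum>v\<in>V. card {w \<in> V. (v, w) \<in> E})" by (rule sum_mono2) (use assms in auto)
  also have "\<dots> = card (SIGMA v:V. {w \<in> V. (v, w) \<in> E})" by (rule card_SigmaI[symmetric]) (use assms in auto)
  also have "(SIGMA v:V. {w \<in> V. (v, w) \<in> E}) = E" using assms by auto
  finally show ?thesis .
qed

text \<open>The pairs are made symmetric, hence the factor 2, and the vertices of degree above
  \<open>L\<close> form \<open>D\<close>. A \<open>k\<close>-chain avoiding \<open>D\<close> is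
  still hit, by a pair that itself avoids \<open>D\<close>.\<close>

lemma poset_free_sparsification:
  fixes F :: "'b set set" and P :: "'a rel"
  assumes tree: "tree_poset P" and free: "poset_free P (inclusion_order F)" and fin: "finite F"
  defines "k \<equiv> poset_height P" and "p \<equiv> card (Field P)"
  obtains D E where "D \<subseteq> F" "card D * L \<le> 2 * (p * (k * k * card F))" "sparsely_hit k L (F - D) E"
proof -
  obtain E where E: "finite E" "irrefl E" "E \<subseteq> F \<times> F" "card E \<le> p * (k * k * card F)"
    and hit: "\<forall>c. length c = k \<and> sorted_wrt (<) c \<and> set c \<subseteq> F \<longrightarrow> (\<exists>v\<in>set c. \<exists>w\<in>set c. (v, w) \<in> E)"
    by (rule poset_free_hitting_pairs[OF tree free fin, folded k_def p_def])
  define S where "S = E \<union> E\<inverse>"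
  have S: "finite S" "S \<subseteq> F \<times> F" "irrefl S" "sym S"
    using E by (auto simp: S_def irrefl_def sym_def)
  have "card S \<le> card E + card (E\<inverse>)" unfolding S_def by (rule card_Un_le)
  then have cardS: "card S \<le> 2 * (p * (k * k * card F))" using E(4) by simp
  define D where "D = {v \<in> F. L < card {w \<in> F. (v, w) \<in> S}}"
  define G where "G = F - D"
  define R where "R = S \<inter> G \<times> G"
  have "card D * L \<le> 2 * (p * (k * k * card F))"
    using card_high_degree[OF fin S(1,2), of L] cardS unfolding D_def by linarith
  moreover have "sparsely_hit k L G R"
    unfolding sparsely_hit_def
  proof (intro conjI allI impI)
    show "irrefl R" "sym R" using S by (auto simp: R_def irrefl_def sym_def)
  next
    fix v
    show "card {w \<in> G. (v, w) \<in> R} \<le> L"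
    proof (cases "v \<in> G")
      case True
      have "card {w \<in> G. (v, w) \<in> R} \<le> card {w \<in> F. (v, w) \<in> S}"
        by (rule card_mono) (use fin in \<open>auto simp: R_def G_def\<close>)
      then show ?thesis using True by (auto simp: G_def D_def)
    next
      case False
      then have none: "{w \<in> G. (v, w) \<in> R} = {}" by (auto simp: R_def)
      show ?thesis unfolding none by simp
    qed
  next
    fix c assume c: "length c = k \<and> sorted_wrt (<) c \<and> set c \<subseteq> G"
    then have "\<exists>v\<in>set c. \<exists>w\<in>set c. (v, w) \<in> E" by (intro hit[rule_format]) (auto simp: G_def)
    then show "\<exists>v\<in>set c. \<exists>w\<in>set c. (v, w) \<in> R" using c by (auto simp: R_def S_def)
  qed
  ultimately show ?thesis using that[of D R] by (auto simp: D_def G_def)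
qed

text \<open>
  Numbering the elements of P by rank * |P| + index is a linear extension, so P is contained in
  every chain with height * |P| elements.
\<close>

lemma poset_free_card_on_chain:
  fixes F :: "'b set set" and P :: "'a rel"
  assumes finP: "finite (Field P)" and po: "Partial_order P" and free: "poset_free P (inclusion_order F)"
    and fin: "finite F"
  shows "card {v \<in> F. on_chain xs v} \<le> poset_height P * card (Field P)"
proof (rule ccontr)
  let ?k = "poset_height P" and ?p = "card (Field P)" and ?r = "poset_rank P"
  define X where "X = {v \<in> F. on_chain xs v}"
  assume "\<not> ?thesis"
  then have big: "?k * ?p < card X" by (simp add: X_def)
  have finX: "finite X" using fin by (simp add: X_def)
  define l where "l = sorted_list_of_set (card ` X)"
  have "inj_on card X" by (rule inj_onI) (auto simp: X_def on_chain_def)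
  then have len: "length l = card X" using finX by (simp add: l_def card_image)
  have setl: "set l = card ` X" using finX by (simp add: l_def)
  have sl: "sorted_wrt (<) l" by (simp add: l_def)
  \<comment> \<open>A set on the chain is the prefix of its own size, so the sorted sizes
    \<open>l\<close> recover the members of \<open>X\<close> in increasing order.\<close>
  define e where "e i = set (take (l ! i) xs)" for i
  have e: "e i \<in> X \<and> card (e i) = l ! i" if i: "i < length l" for i
  proof -
    have "l ! i \<in> card ` X" using i setl by (metis nth_mem)
    then show ?thesis by (auto simp: X_def e_def on_chain_def)
  qed
  have e_mono: "e i \<subseteq> e j" if "i \<le> j" "j < length l" for i j
  proof -
    have "l ! i \<le> l ! j" using sl that by (metis le_neq_implies_less less_imp_le order_refl sorted_wrt_nth_less)
    then show ?thesis unfolding e_def by (rule set_take_subset_set_take)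
  qed
  have e_inj: "i = j" if "e i = e j" "i < length l" "j < length l" for i j
    using e[OF that(2)] e[OF that(3)] that(1) sl that
    by (metis linorder_neqE_nat order_less_irrefl sorted_wrt_nth_less)
  obtain g where g: "bij_betw g (Field P) {0..<?p}" using ex_bij_betw_finite_nat[OF finP] by blast
  have g_less: "g x < ?p" if "x \<in> Field P" for x using bij_betwE[OF g] that by auto
  define f where "f x = ?r x * ?p + g x" for x
  have f_less: "f x < length l" if x: "x \<in> Field P" for x
  proof -
    have "f x < Suc (?r x) * ?p" using g_less[OF x] by (simp add: f_def)
    also have "\<dots> \<le> ?k * ?p" using poset_rank_less_height[OF finP po x] by (intro mult_le_mono1) simp
    finally show ?thesis using big len by simp
  qed
  have "poset_contains (inclusion_order F) P"
  proof (rule poset_containsI[of "e \<circ> f"])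
    show "inj_on (e \<circ> f) (Field P)"
    proof (rule inj_onI)
      fix x y assume x: "x \<in> Field P" and y: "y \<in> Field P" and eq: "(e \<circ> f) x = (e \<circ> f) y"
      have "f x = f y" using eq e_inj f_less x y by simp
      then have "f x mod ?p = f y mod ?p" by simp
      then have "g x = g y" using g_less x y by (simp add: f_def)
      then show "x = y" using g x y by (auto simp: bij_betw_def dest: inj_onD)
    qed
    show "(e \<circ> f) ` Field P \<subseteq> F" using e f_less by (auto simp: X_def)
    show "(e \<circ> f) x \<subseteq> (e \<circ> f) y" if xy: "(x, y) \<in> P" for x y
    proof (cases "x = y")
      case False
      then have less: "poset_less P x y" using xy by (simp add: poset_less_def)
      have F: "x \<in> Field P" "y \<in> Field P" using xy by (auto simp: Field_def)
      have "f x \<le> Suc (?r x) * ?p" using g_less[OF F(1)] by (simp add: f_def)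
      also have "\<dots> \<le> ?r y * ?p" using poset_rank_mono[OF finP po less] by (intro mult_le_mono1) simp
      also have "\<dots> \<le> f y" by (simp add: f_def)
      finally have "f x \<le> f y" .
      then show ?thesis using e_mono f_less[OF F(2)] by simp
    qed simp
  qed
  then show False using free by simp
qed

lemma card_le_binomial_sum:
  assumes "finite \<Omega>" "A \<subseteq> Pow \<Omega>"
  shows "real (card A) \<le> (\<Sum>v\<in>A. 1 / real (card \<Omega> choose card v)) * real (card \<Omega> choose (card \<Omega> div 2))"
proof -
  let ?N = "card \<Omega> choose (card \<Omega> div 2)"
  have "1 \<le> 1 / real (card \<Omega> choose card v) * real ?N" if "v \<in> A" for v
  proof -
    have "card v \<le> card \<Omega>" using that assms by (intro card_mono) auto
    then have "0 < card \<Omega> choose card v" by simp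
    then show ?thesis using binomial_maximum[of "card \<Omega>" "card v"] by (simp add: field_simps)
  qed
  then have "(\<Sum>v\<in>A. 1) \<le> (\<Sum>v\<in>A. 1 / real (card \<Omega> choose card v) * real ?N)" by (rule sum_mono)
  then show ?thesis by (simp add: sum_distrib_right)
qed

text \<open>A crude bound with a constant worse than \<open>k - 1\<close>; it only has to show that
  a family has O(N) members, so that few vertices have high degree.\<close>

lemma poset_free_card_le:
  assumes "finite (Field P)" "Partial_order P" "poset_free P (inclusion_order F)" "finite \<Omega>" "F \<subseteq> Pow \<Omega>"
  shows "card F \<le> poset_height P * card (Field P) * (card \<Omega> choose (card \<Omega> div 2))"
proof -
  have fF: "finite F" using finite_subset[OF assms(5)] assms(4) by simp
  have "(\<Sum>v\<in>F. 1 / real (card \<Omega> choose card v)) \<le> real (poset_height P * card (Field P))"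
    by (rule LYM_bound[OF assms(4,5)]) (rule poset_free_card_on_chain[OF assms(1-3) fF])
  then have "(\<Sum>v\<in>F. 1 / real (card \<Omega> choose card v)) * real (card \<Omega> choose (card \<Omega> div 2))
     \<le> real (poset_height P * card (Field P)) * real (card \<Omega> choose (card \<Omega> div 2))"
    by (rule mult_right_mono) simp
  from order_trans[OF card_le_binomial_sum[OF assms(4,5)] this]
  have "real (card F) \<le> real (poset_height P * card (Field P) * (card \<Omega> choose (card \<Omega> div 2)))" by simp
  then show ?thesis by (simp only: of_nat_le_iff)
qed

section \<open>Counting small subfamilies and outer sets\<close>

lemma sum_power_card_Pow:
  assumes "finite A"
  shows "(\<Sum>X\<in>Pow A. x ^ card X) = (1 + x :: real) ^ card A"
  using prod_add[OF assms, of "\<lambda>_. x" "\<lambda>_. 1"] by (simp add: add.commute)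

text \<open>Exponential Markov bound: every counted set has weight \<open>x ^ (h - card D)\<close>
  at least 1, and the binomial theorem sums the weights over all subsets.\<close>

lemma card_small_subsets_le:
  fixes x :: real
  assumes "finite A" "1 \<le> x"
  shows "real (card {D \<in> Pow A. card D \<le> h}) \<le> x ^ h * (1 + 1 / x) ^ card A"
proof -
  have "real (card {D \<in> Pow A. card D \<le> h}) = (\<Sum>D\<in>{D \<in> Pow A. card D \<le> h}. 1)" by simp
  also have "\<dots> \<le> (\<Sum>D\<in>{D \<in> Pow A. card D \<le> h}. x ^ h * (1 / x) ^ card D)"
  proof (rule sum_mono)
    fix D assume "D \<in> {D \<in> Pow A. card D \<le> h}"
    then have "x ^ card D \<le> x ^ h" using assms by (intro power_increasing) auto
    then show "1 \<le> x ^ h * (1 / x) ^ card D" using assms by (simp add: power_divide field_simps)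
  qed
  also have "\<dots> \<le> (\<Sum>D\<in>Pow A. x ^ h * (1 / x) ^ card D)"
    by (rule sum_mono2) (use assms in auto)
  also have "\<dots> = x ^ h * (1 + 1 / x) ^ card A"
    using sum_power_card_Pow[OF assms(1), of "1 / x"] by (simp add: sum_distrib_left[symmetric])
  finally show ?thesis .
qed

text \<open>One-sided because the walk goes upwards: its step probabilities are small if a quarter
  of the ground set is left above, whereas at the bottom only the weight of the empty set is too
  large.\<close>

definition outer_sets :: "'a set \<Rightarrow> 'a set set" where
  "outer_sets \<Omega> = {v \<in> Pow \<Omega>. v = {} \<or> 3 * card \<Omega> < 4 * card v}"

text \<open>Chernoff-type bound: \<open>v\<close> gets weight \<open>2 ^ card v\<close>, and the
  total weight of all subsets is \<open>3 ^ card \<Omega>\<close>.\<close>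

lemma card_outer_sets_le:
  assumes "finite \<Omega>"
  shows "real (card (outer_sets \<Omega>)) \<le> 1 + 3 ^ card \<Omega> / 2 powr (3 * real (card \<Omega>) / 4)"
proof -
  let ?B = "{v \<in> Pow \<Omega>. 3 * card \<Omega> < 4 * card v}"
  let ?y = "2 powr (3 * real (card \<Omega>) / 4)"
  have "real (card ?B) * ?y = (\<Sum>v\<in>?B. ?y)" by simp
  also have "\<dots> \<le> (\<Sum>v\<in>?B. 2 ^ card v)"
  proof (rule sum_mono)
    fix v assume "v \<in> ?B"
    then have "3 * real (card \<Omega>) / 4 \<le> real (card v)" by auto
    then have "?y \<le> 2 powr real (card v)" by (intro powr_mono) auto
    then show "?y \<le> 2 ^ card v" by (simp add: powr_realpow)
  qed
  also have "\<dots> \<le> (\<Sum>v\<in>Pow \<Omega>. 2 ^ card v)" by (rule sum_mono2) (use assms in auto)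
  also have "\<dots> = 3 ^ card \<Omega>" using sum_power_card_Pow[OF assms, of 2] by simp
  finally have "real (card ?B) \<le> 3 ^ card \<Omega> / ?y" by (simp add: pos_le_divide_eq)
  moreover have "outer_sets \<Omega> \<subseteq> insert {} ?B" by (auto simp: outer_sets_def)
  then have "card (outer_sets \<Omega>) \<le> card (insert {} ?B)" by (rule card_mono[rotated]) (use assms in auto)
  moreover have "card (insert {} ?B) \<le> Suc (card ?B)" by (rule card_insert_le_m1) auto
  ultimately show ?thesis by linarith
qed

text \<open>A family is the union of its outer part, the deleted set \<open>D\<close> and a sparsely
  hit rest; the three factors bound the choices for each. The hypothesis on \<open>T\<close> says
  that more than \<open>T\<close> middle sets are too many for the inequality of
  \<open>supersaturation\<close>.\<close>

lemma card_poset_free_le: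
  fixes \<Omega> :: "'b set" and P :: "'a rel" and x lam mu :: real
  assumes tree: "tree_poset P" and fin: "finite \<Omega>" and n: "0 < card \<Omega>" and m: "1 \<le> m" and L: "1 \<le> L"
    and x: "1 \<le> x" and lam: "1 + 2 / mu \<le> lam" and mu: "1 \<le> mu"
  defines "k \<equiv> poset_height P" and "p \<equiv> card (Field P)"
    and "N \<equiv> card \<Omega> choose (card \<Omega> div 2)"
  assumes k: "1 \<le> k"
    and T: "\<And>s. real T < s * real N \<Longrightarrow>
        real m * (4 / real (card \<Omega>)) * (1 + real (k - 1) * s) < s - real (k - 1)"
    and h: "2 * (p * (k * k * (k * p * N))) \<le> h * L"
  shows "real (card {F. F \<subseteq> Pow \<Omega> \<and> poset_free P (inclusion_order F)}) \<le>
    2 ^ card (outer_sets \<Omega>) * (x ^ h * (1 + 1 / x) ^ (2 ^ card \<Omega>)) *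
      (2 ^ T * lam ^ (2 ^ card \<Omega>) * mu ^ ((k + k * L) * (2 ^ card \<Omega> div m)))"
proof -
  define Mid where "Mid = Pow \<Omega> - outer_sets \<Omega>"
  have finM: "finite Mid" using fin by (simp add: Mid_def)
  have finO: "finite (outer_sets \<Omega>)" using fin by (simp add: outer_sets_def)
  have finP: "finite (Field P)" and po: "Partial_order P" using tree by (auto simp: tree_poset_def)
  let ?Fam = "{F. F \<subseteq> Pow \<Omega> \<and> poset_free P (inclusion_order F)}"
  let ?Dom = "Pow (outer_sets \<Omega>) \<times> {D \<in> Pow (Pow \<Omega>). card D \<le> h} \<times> sparse_families k L Mid Mid {}"
  have finS: "finite (sparse_families k L Mid Mid {})"
    by (rule finite_subset[of _ "Pow Mid"]) (use finM in \<open>auto simp: sparse_families_def\<close>)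
  have "?Fam \<subseteq> (\<lambda>(O', D, G). O' \<union> D \<union> G) ` ?Dom"
  proof
    fix F assume "F \<in> ?Fam"
    then have F: "F \<subseteq> Pow \<Omega>" and free: "poset_free P (inclusion_order F)" by auto
    define F' where "F' = F \<inter> Mid"
    have F': "F' \<subseteq> Pow \<Omega>" "finite F'" using F finM by (auto simp: F'_def)
    have free': "poset_free P (inclusion_order F')"
      using free poset_contains_mono[of F' P F] by (auto simp: F'_def)
    obtain D E where D: "D \<subseteq> F'" "card D * L \<le> 2 * (p * (k * k * card F'))" and E: "sparsely_hit k L (F' - D) E"
      by (rule poset_free_sparsification[OF tree free' F'(2), of L, folded k_def p_def])
    have "card F' \<le> k * p * N"
      unfolding k_def p_def N_def by (rule poset_free_card_le[OF finP po free' fin F'(1)])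
    then have "2 * (p * (k * k * card F')) \<le> 2 * (p * (k * k * (k * p * N)))"
      by (intro mult_le_mono2)
    then have "card D * L \<le> h * L" using D(2) h by linarith
    then have "card D \<le> h" using L by simp
    moreover have "F' - D \<in> sparse_families k L Mid Mid {}"
      using E by (auto simp: sparse_families_def F'_def)
    ultimately have "(F \<inter> outer_sets \<Omega>, D, F' - D) \<in> ?Dom" using D(1) F' by auto
    moreover have "F = (F \<inter> outer_sets \<Omega>) \<union> D \<union> (F' - D)"
      using F D(1) by (auto simp: F'_def Mid_def)
    ultimately show "F \<in> (\<lambda>(O', D, G). O' \<union> D \<union> G) ` ?Dom"
      by (intro image_eqI[of _ _ "(F \<inter> outer_sets \<Omega>, D, F' - D)"]) auto
  qed
  then have "card ?Fam \<le> card ((\<lambda>(O', D, G). O' \<union> D \<union> G) ` ?Dom)"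
    by (rule card_mono[rotated]) (use finO fin finS in simp)
  also have "\<dots> \<le> card ?Dom" by (rule card_image_le) (use finO fin finS in simp)
  also have "\<dots> = 2 ^ card (outer_sets \<Omega>) * (card {D \<in> Pow (Pow \<Omega>). card D \<le> h} * card (sparse_families k L Mid Mid {}))"
    using finO by (simp add: card_cartesian_product card_Pow)
  finally have "real (card ?Fam) \<le> real (2 ^ card (outer_sets \<Omega>) * (card {D \<in> Pow (Pow \<Omega>). card D \<le> h} * card (sparse_families k L Mid Mid {})))"
    by (rule of_nat_mono)
  also have "\<dots> = 2 ^ card (outer_sets \<Omega>) * real (card {D \<in> Pow (Pow \<Omega>). card D \<le> h}) * real (card (sparse_families k L Mid Mid {}))"
    by simp
  also have "\<dots> \<le> 2 ^ card (outer_sets \<Omega>) * (x ^ h * (1 + 1 / x) ^ (2 ^ card \<Omega>)) *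
      (2 ^ T * lam ^ (2 ^ card \<Omega>) * mu ^ ((k + k * L) * (2 ^ card \<Omega> div m)))"
  proof (intro mult_mono)
    show "real (card {D \<in> Pow (Pow \<Omega>). card D \<le> h}) \<le> x ^ h * (1 + 1 / x) ^ (2 ^ card \<Omega>)"
      using card_small_subsets_le[of "Pow \<Omega>" x h] fin x by (simp add: card_Pow)
    have rich: "m \<le> card (rich m A (k - 1))" if A: "A \<subseteq> Mid" and T': "T < card A" for A
    proof (rule ccontr)
      assume "\<not> ?thesis"
      then have few: "card (rich m A (k - 1)) < m" by simp
      have A': "A \<subseteq> Pow \<Omega>" using A by (auto simp: Mid_def)
      define s where "s = (\<Sum>v\<in>A. 1 / real (card \<Omega> choose card v))"
      have "real T < s * real N"
        using card_le_binomial_sum[OF fin A'] T' unfolding s_def N_def by linarith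
      moreover have "s - real (k - 1) \<le> real m * (4 / real (card \<Omega>)) * (1 + real (k - 1) * s)"
        unfolding s_def
        by (rule supersaturation[OF fin A' n _ few]) (use A in \<open>auto simp: Mid_def outer_sets_def\<close>)
      ultimately show False using T[of s] by linarith
    qed
    have "real (card (sparse_families k L Mid Mid {})) \<le> 2 ^ T * lam ^ card Mid * mu ^ ((k + k * L) * (card Mid div m))"
      by (rule sparse_families_bound[OF finM k m rich lam mu]) auto
    also have "\<dots> \<le> 2 ^ T * lam ^ (2 ^ card \<Omega>) * mu ^ ((k + k * L) * (2 ^ card \<Omega> div m))"
    proof -
      have "card Mid \<le> card (Pow \<Omega>)" by (rule card_mono) (use fin in \<open>auto simp: Mid_def\<close>)
      then have c: "card Mid \<le> 2 ^ card \<Omega>" using fin by (simp add: card_Pow)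
      have "1 \<le> lam" using lam mu by (smt (verit) divide_nonneg_nonneg)
      then show ?thesis using c mu
        by (intro mult_mono power_increasing mult_le_mono2 div_le_mono) auto
    qed
    finally show "real (card (sparse_families k L Mid Mid {})) \<le> 2 ^ T * lam ^ (2 ^ card \<Omega>) * mu ^ ((k + k * L) * (2 ^ card \<Omega> div m))" .
  qed (use x in auto)
  finally show ?thesis .
qed

section \<open>Asymptotics\<close>

lemma central_binomial_Suc: "(2 * Suc m choose Suc m) * Suc m = 2 * (2 * m + 1) * (2 * m choose m)"
proof -
  have 1: "Suc (2 * m + 1) * (2 * m + 1 choose m) = (Suc (2 * m + 1) choose Suc m) * Suc m"
    by (rule Suc_times_binomial_eq)
  have 2: "Suc (2 * m) * (2 * m choose m) = (Suc (2 * m) choose Suc m) * Suc m"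
    by (rule Suc_times_binomial_eq)
  have 3: "(2 * m + 1 choose m) = (Suc (2 * m) choose Suc m)"
    using binomial_symmetric[of m "2 * m + 1"] by simp
  have "(2 * Suc m choose Suc m) * Suc m = Suc (2 * m + 1) * (2 * m + 1 choose m)"
    using 1 by simp
  also have "\<dots> = 2 * ((Suc (2 * m) choose Suc m) * Suc m)" using 3 by simp
  finally show ?thesis using 2 by simp
qed

text \<open>Squared to stay free of roots. The induction step reduces to 4m(m + 1) being at most (2m
  + 1)^2.\<close>

lemma central_binomial_lower: "1 \<le> m \<Longrightarrow> (4 ^ m)\<^sup>2 \<le> 4 * real m * (real (2 * m choose m))\<^sup>2"
proof (induction m rule: nat_induct_at_least)
  case base
  show ?case by simp
next
  case (Suc m)
  let ?b = "real (2 * m choose m)" and ?c = "real (2 * Suc m choose Suc m)"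
  have "real ((2 * Suc m choose Suc m) * Suc m) = real (2 * (2 * m + 1) * (2 * m choose m))"
    by (simp only: central_binomial_Suc)
  then have eq: "?c * (real m + 1) = 2 * (2 * real m + 1) * ?b" by (simp add: algebra_simps)
  have m: "0 < real m" using Suc.hyps by simp
  have "(4 ^ Suc m)\<^sup>2 = 16 * (4 ^ m :: real)\<^sup>2" by (simp add: power2_eq_square)
  also have "\<dots> \<le> 16 * (4 * real m * ?b\<^sup>2)" using Suc.IH by simp
  finally have "(4 ^ Suc m)\<^sup>2 * (real m + 1) \<le> 16 * (4 * real m * ?b\<^sup>2) * (real m + 1)"
    by (rule mult_right_mono) simp
  also have "\<dots> = 4 * ?b\<^sup>2 * (4 * (4 * real m * (real m + 1)))" by (simp add: algebra_simps)
  also have "\<dots> \<le> 4 * ?b\<^sup>2 * (4 * (2 * real m + 1)\<^sup>2)"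
    by (intro mult_left_mono) (auto simp: power2_eq_square algebra_simps)
  also have "\<dots> = 4 * (2 * (2 * real m + 1) * ?b)\<^sup>2" by (simp add: power2_eq_square algebra_simps)
  also have "\<dots> = 4 * (real m + 1) * ?c\<^sup>2 * (real m + 1)"
    unfolding eq[symmetric] by (simp add: power2_eq_square algebra_simps)
  finally have "(4 ^ Suc m)\<^sup>2 \<le> 4 * (real m + 1) * ?c\<^sup>2"
    using m by (simp only: mult_le_cancel_right_pos)
  then show ?case by (simp add: add.commute)
qed

text \<open>The loss of order sqrt n between the number of all sets and N is what every error term
  has to beat. Odd \<open>n\<close> reduces to the even case since (2m + 2 choose m + 1) is twice
  (2m + 1 choose m).\<close>

lemma power2_le_central_binomial:
  assumes "1 \<le> n"
  shows "2 ^ n \<le> 2 * sqrt (real n) * real (n choose (n div 2))"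
proof -
  have even_case: "4 ^ m \<le> 2 * sqrt (real m) * real (2 * m choose m)" if "1 \<le> m" for m :: nat
  proof -
    have "(4 ^ m)\<^sup>2 \<le> (2 * sqrt (real m) * real (2 * m choose m))\<^sup>2"
      using central_binomial_lower[OF that] by (simp add: power_mult_distrib)
    then show ?thesis by (rule power2_le_imp_le) simp
  qed
  show ?thesis
  proof (cases "even n")
    case True
    then obtain m where n: "n = 2 * m" by (elim evenE)
    have "2 * sqrt (real m) * real (2 * m choose m) \<le> 2 * sqrt (real n) * real (2 * m choose m)"
      using n by (intro mult_right_mono mult_left_mono) auto
    moreover have "4 ^ m \<le> 2 * sqrt (real m) * real (2 * m choose m)"
      by (rule even_case) (use assms n in simp)
    moreover have "(2::real) ^ n = 4 ^ m" "n div 2 = m" using n by (simp_all add: power_mult)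
    ultimately show ?thesis using n by (metis order_trans)
  next
    case False
    then obtain m where n: "n = 2 * m + 1" by (elim oddE)
    have "(2 * Suc m choose Suc m) = (2 * m + 1 choose m) + (2 * m + 1 choose Suc m)" by simp
    also have "(2 * m + 1 choose Suc m) = (2 * m + 1 choose m)"
      using binomial_symmetric[of m "2 * m + 1"] by simp
    finally have c: "real (2 * Suc m choose Suc m) = 2 * real (2 * m + 1 choose m)" by simp
    have "4 ^ Suc m \<le> 2 * sqrt (real (Suc m)) * real (2 * Suc m choose Suc m)"
      by (rule even_case) simp
    then have "2 * 2 ^ n \<le> 2 * (2 * sqrt (real (Suc m)) * real (n choose (n div 2)))"
      unfolding c by (simp add: n power_mult)
    then have "2 ^ n \<le> 2 * sqrt (real (Suc m)) * real (n choose (n div 2))" by simp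
    also have "\<dots> \<le> 2 * sqrt (real n) * real (n choose (n div 2))"
      using n by (intro mult_right_mono mult_left_mono) auto
    finally show ?thesis .
  qed
qed

lemma near_central_binomial_tendsto:
  "(\<lambda>n. real (n choose (n div 2 + i)) / real (n choose (n div 2))) \<longlonglongrightarrow> 1"
proof (induction i)
  case 0
  have "real (n choose (n div 2 + 0)) / real (n choose (n div 2)) = 1" for n by simp
  then show ?case by simp
next
  case (Suc i)
  let ?r = "\<lambda>n. (real n - real (n div 2) - real i) / (real (n div 2) + real i + 1)"
  have "(\<lambda>n. ?r n - 1) \<longlonglongrightarrow> 0"
  \<comment> \<open>The numerator of the difference is n - 2(n div 2) - 2i - 1, of absolute value at
    most 2i + 2, and the denominator is at least n / 2.\<close>
  proof (rule tendsto_0_le[where f = "\<lambda>n. 2 / real n" and K = "2 * real i + 2"])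
    show "\<forall>\<^sub>F n in sequentially. norm (?r n - 1) \<le> norm (2 / real n) * (2 * real i + 2)"
    proof (rule eventually_sequentiallyI[of 1])
      fix n :: nat assume n: "1 \<le> n"
      define d where "d = real (n div 2)"
      have d: "2 * d \<le> real n" "real n \<le> 2 * d + 1"
        unfolding d_def by linarith+
      have "?r n - 1 = (real n - 2 * d - 2 * real i - 1) / (d + real i + 1)"
        using d n by (simp add: d_def[symmetric] field_simps)
      then have "norm (?r n - 1) = \<bar>real n - 2 * d - 2 * real i - 1\<bar> / (d + real i + 1)"
        using d n by simp
      also have "\<dots> \<le> (2 * real i + 2) / (real n / 2)"
        by (rule frac_le) (use d n in auto)
      finally show "norm (?r n - 1) \<le> norm (2 / real n) * (2 * real i + 2)" by (simp add: mult.commute)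
    qed
    show "(\<lambda>n. 2 / real n) \<longlonglongrightarrow> 0" by real_asymp
  qed
  then have r: "?r \<longlonglongrightarrow> 1" by (simp add: LIM_zero_iff)
  have "(\<lambda>n. real (n choose (n div 2 + i)) / real (n choose (n div 2)) * ?r n) \<longlonglongrightarrow> 1 * 1"
    by (rule tendsto_mult[OF Suc.IH r])
  moreover have "\<forall>\<^sub>F n in sequentially. real (n choose (n div 2 + i)) / real (n choose (n div 2)) * ?r n
      = real (n choose (n div 2 + Suc i)) / real (n choose (n div 2))"
  proof (rule eventually_sequentiallyI[of "2 * i + 2"])
    fix n assume n: "2 * i + 2 \<le> n"
    let ?j = "n div 2 + i"
    have j: "?j < n" using n by linarith
    have "(n choose Suc ?j) * Suc ?j = (n choose ?j) * (n - ?j)"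
      using binomial_absorb_comp[of n ?j] Suc_times_binomial_eq[of "n - 1" ?j] j
      by (simp add: mult.commute)
    then have "real (n choose Suc ?j) * real (Suc ?j) = real (n choose ?j) * real (n - ?j)"
      by (simp only: of_nat_mult[symmetric])
    moreover have "real (Suc ?j) = real (n div 2) + real i + 1"
      "real (n - ?j) = real n - real (n div 2) - real i"
      using j by auto
    ultimately have "real (n choose Suc ?j) * (real (n div 2) + real i + 1) = real (n choose ?j) * (real n - real (n div 2) - real i)"
      by (simp only:)
    moreover have "real (n div 2) + real i + 1 \<noteq> 0" by linarith
    ultimately have "real (n choose Suc ?j) = real (n choose ?j) * ?r n"
      by (metis nonzero_eq_divide_eq times_divide_eq_right)
    then show "real (n choose (n div 2 + i)) / real (n choose (n div 2)) * ?r n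
      = real (n choose (n div 2 + Suc i)) / real (n choose (n div 2))"
      by (simp only: add_Suc_right times_divide_eq_left)
  qed
  ultimately show ?case unfolding mult_1 by (rule Lim_transform_eventually)
qed

text \<open>A longest chain of \<open>P\<close> would need \<open>poset_height P\<close> different
  cardinalities, one more than there are levels.\<close>

lemma poset_free_middle_levels:
  fixes P :: "'a rel"
  assumes finP: "finite (Field P)" and po: "Partial_order P"
    and F: "\<And>v. v \<in> F \<Longrightarrow> finite v \<and> l \<le> card v \<and> card v < l + (poset_height P - 1)"
    and k: "1 \<le> poset_height P"
  shows "poset_free P (inclusion_order F)"
proof
  let ?k = "poset_height P"
  assume "poset_contains (inclusion_order F) P"
  then obtain \<phi> where inj: "inj_on \<phi> (Field P)" and im: "\<phi> ` Field P \<subseteq> F"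
    and mono: "\<And>x y. (x, y) \<in> P \<Longrightarrow> (\<phi> x, \<phi> y) \<in> inclusion_order F"
    unfolding poset_contains_def by auto
  obtain C where C: "C \<in> Chains P" "card C = ?k" by (rule poset_height_attained[OF finP po])
  have CF: "C \<subseteq> Field P" using C(1) Chains_subset_Pow by blast
  have finC: "finite C" using CF finP finite_subset by blast
  have "inj_on (\<lambda>x. card (\<phi> x)) C"
  proof (rule inj_onI)
    fix x y assume x: "x \<in> C" and y: "y \<in> C" and eq: "card (\<phi> x) = card (\<phi> y)"
    have "(x, y) \<in> P \<or> (y, x) \<in> P" using C(1) x y by (auto simp: Chains_def)
    then have "\<phi> x \<subseteq> \<phi> y \<or> \<phi> y \<subseteq> \<phi> x" using mono by (auto simp: inclusion_order_def relation_of_def)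
    moreover have "finite (\<phi> x)" "finite (\<phi> y)" using F im CF x y by blast+
    ultimately have "\<phi> x = \<phi> y" using eq card_subset_eq by metis
    then show "x = y" using inj CF x y by (auto dest: inj_onD)
  qed
  then have "card ((\<lambda>x. card (\<phi> x)) ` C) = ?k" using C(2) by (simp add: card_image)
  moreover have "(\<lambda>x. card (\<phi> x)) ` C \<subseteq> {l..<l + (?k - 1)}" using F im CF by fastforce
  then have "card ((\<lambda>x. card (\<phi> x)) ` C) \<le> card {l..<l + (?k - 1)}" by (rule card_mono[rotated]) simp
  ultimately show False using k by simp
qed

abbreviation count_free :: "'a rel \<Rightarrow> nat \<Rightarrow> nat" where
  "count_free P n \<equiv> card {\<F> :: nat set set. \<F> \<subseteq> Pow {1..n} \<and> poset_free P (inclusion_order \<F>)}"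

lemma finite_free_families: "finite {\<F> :: nat set set. \<F> \<subseteq> Pow {1..n} \<and> poset_free P (inclusion_order \<F>)}"
  by (rule finite_subset[of _ "Pow (Pow {1..n})"]) auto

lemma count_free_lower:
  fixes P :: "'a rel"
  assumes "finite (Field P)" "Partial_order P" "1 \<le> poset_height P"
  shows "2 ^ (\<Sum>i<poset_height P - 1. n choose (n div 2 + i)) \<le> count_free P n"
proof -
  let ?k = "poset_height P"
  define M where "M = {v \<in> Pow {1..n}. n div 2 \<le> card v \<and> card v < n div 2 + (?k - 1)}"
  have "M = (\<Union>i<?k - 1. {v. v \<subseteq> {1..n} \<and> card v = n div 2 + i})"
  proof -
    have "\<exists>i<?k - 1. c = n div 2 + i" if "n div 2 \<le> c" "c < n div 2 + (?k - 1)" for c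
      using that by (intro exI[of _ "c - n div 2"]) auto
    then show ?thesis by (auto simp: M_def)
  qed
  then have "card M = (\<Sum>i<?k - 1. card {v. v \<subseteq> {1..n} \<and> card v = n div 2 + i})"
    by (simp only:) (rule card_UN_disjoint, auto intro: finite_subset[of _ "Pow {1..n}"])
  also have "\<dots> = (\<Sum>i<?k - 1. n choose (n div 2 + i))" by (simp add: n_subsets)
  finally have cM: "card M = (\<Sum>i<?k - 1. n choose (n div 2 + i))" .
  have finM: "finite M" by (simp add: M_def)
  have "poset_free P (inclusion_order \<F>)" if "\<F> \<subseteq> M" for \<F> :: "nat set set"
  proof (rule poset_free_middle_levels[OF assms(1,2) _ assms(3), of _ "n div 2"])
    fix v assume "v \<in> \<F>"
    then have v: "v \<subseteq> {1..n}" "n div 2 \<le> card v \<and> card v < n div 2 + (?k - 1)"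
      using that by (auto simp: M_def)
    then show "finite v \<and> n div 2 \<le> card v \<and> card v < n div 2 + (?k - 1)"
      using finite_subset[OF v(1)] by simp
  qed
  then have "Pow M \<subseteq> {\<F>. \<F> \<subseteq> Pow {1..n} \<and> poset_free P (inclusion_order \<F>)}"
    by (auto simp: M_def)
  then have "card (Pow M) \<le> count_free P n" by (rule card_mono[OF finite_free_families])
  then show ?thesis using finM cM by (simp add: card_Pow)
qed

lemma poset_height_pos:
  assumes "tree_poset P"
  shows "1 \<le> poset_height P"
proof -
  obtain x where "x \<in> Field P" using assms by (auto simp: tree_poset_def graph_tree_def)
  then have "poset_rank P x < poset_height P"
    using assms poset_rank_less_height[of P x] by (simp add: tree_poset_def)
  then show ?thesis by simp
qed

lemma empty_poset_free:
  assumes "tree_poset P"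
  shows "poset_free P (inclusion_order {})"
  using assms by (auto simp: poset_contains_def tree_poset_def graph_tree_def)

section \<open>Choice of parameters and the error terms\<close>

lemma power_times_sqrt_tendsto_0:
  fixes r :: real
  assumes "0 < r" "r < 1"
  shows "(\<lambda>n. r ^ n * (2 * sqrt (real n))) \<longlonglongrightarrow> 0"
  using assms by real_asymp

lemma eventually_log_count_free_le:
  fixes P :: "'a rel" and e :: real
  assumes tree: "tree_poset P" and k: "2 \<le> poset_height P" and e: "0 < e" "e \<le> 1"
  shows "\<forall>\<^sub>F n in sequentially. log 2 (real (count_free P n)) \<le>
    (real (poset_height P) - 1 + 2 * e) * real (n choose (n div 2))"
proof -
  define k where "k = poset_height P"
  define p where "p = card (Field P)"
  define c where "c = real (2 * (p * (k * k * (k * p))))"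
  \<comment> \<open>Chosen so that the error in \<open>supersaturation\<close>, at most
    \<open>4 * \<delta> * (k * s)\<close>, equals \<open>e / (2 * k) * s\<close>.\<close>
  define \<delta> where "\<delta> = e / (8 * real k * real k)"
  have k2: "2 \<le> k" using k by (simp add: k_def)
  have d0: "0 < \<delta>" using e k2 by (simp add: \<delta>_def)
  have c0: "0 \<le> c" by (simp add: c_def)
  define u where "u n = 2 * sqrt (real n) / 2 ^ n" for n :: nat
  \<comment> \<open>All error terms in bits, divided by N: outer sets, deleted sets, query factors
    together with the rounding of \<open>T\<close>, and positive answers. The function
    \<open>u\<close> bounds 1 / N and so absorbs additive constants.\<close>
  define R where "R n = (1 + 3 ^ n / 2 powr (3 * real n / 4)) * u n
     + (c / real n powr (1 / 4) + u n) * log 2 (real n)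
     + 2 * (2 * sqrt (real n) * log 2 (1 + 1 / real n)) + u n
     + (2 * real k + real k * real n powr (1 / 4)) * (2 * sqrt (real n) / (\<delta> * real n - 1)) * log 2 (2 * real n)" for n :: nat
  have "R \<longlonglongrightarrow> 0"
  proof -
    have "(\<lambda>n. 2 * sqrt (real n) / 2 ^ n + (3 / 2 powr (7 / 4)) ^ n * (2 * sqrt (real n))) \<longlonglongrightarrow> 0 + 0"
    proof (rule tendsto_add)
      \<comment> \<open>3 is below 2 powr (7/4) because 3^4 = 81 is below 2^7 = 128; hence the outer
        sets are exponentially rare.\<close>
      have "(81::real) powr (1 / 4) < 128 powr (1 / 4)" by (rule powr_less_mono2) auto
      also have "(81::real) powr (1 / 4) = (3 powr 4) powr (1 / 4)" by simp
      also have "\<dots> = 3" by (simp only: powr_powr) simp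
      also have "(128::real) powr (1 / 4) = (2 powr 7) powr (1 / 4)" by simp
      also have "\<dots> = 2 powr (7 / 4)" by (simp only: powr_powr) simp
      finally have r: "3 / 2 powr (7 / 4) < (1::real)" "0 < 3 / (2::real) powr (7 / 4)" by simp_all
      show "(\<lambda>n. (3 / 2 powr (7 / 4)) ^ n * (2 * sqrt (real n))) \<longlonglongrightarrow> 0"
        using power_times_sqrt_tendsto_0[OF r(2,1)] by simp
    qed real_asymp
    moreover have "(3 / 2 powr (7 / 4)) ^ n = 3 ^ n / 2 powr (3 * real n / 4) / (2::real) ^ n" for n :: nat
      by (simp add: power_divide powr_realpow[symmetric] powr_powr powr_add[symmetric] algebra_simps)
    ultimately have "(\<lambda>n. (1 + 3 ^ n / 2 powr (3 * real n / 4)) * (2 * sqrt (real n) / 2 ^ n)) \<longlonglongrightarrow> 0"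
      by (simp add: algebra_simps)
    moreover have "(\<lambda>n. c * (1 / real n powr (1 / 4) * log 2 (real n))) \<longlonglongrightarrow> 0"
      by (intro tendsto_mult_right_zero) real_asymp
    moreover have "(\<lambda>n. 2 * sqrt (real n) / 2 ^ n * log 2 (real n)) \<longlonglongrightarrow> 0"
      by real_asymp
    moreover have "(\<lambda>n. 2 * (2 * sqrt (real n) * log 2 (1 + 1 / real n)) + 2 * sqrt (real n) / 2 ^ n) \<longlonglongrightarrow> 0"
      by real_asymp
    moreover have "(\<lambda>n. real k * ((2 + real n powr (1 / 4)) * (2 * sqrt (real n) / (\<delta> * real n - 1)) * log 2 (2 * real n))) \<longlonglongrightarrow> 0"
      by (intro tendsto_mult_right_zero) (use d0 in real_asymp)
    ultimately have "(\<lambda>n. (1 + 3 ^ n / 2 powr (3 * real n / 4)) * (2 * sqrt (real n) / 2 ^ n) +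
        (c * (1 / real n powr (1 / 4) * log 2 (real n)) +
        (2 * sqrt (real n) / 2 ^ n * log 2 (real n) +
        ((2 * (2 * sqrt (real n) * log 2 (1 + 1 / real n)) + 2 * sqrt (real n) / 2 ^ n) +
        real k * ((2 + real n powr (1 / 4)) * (2 * sqrt (real n) / (\<delta> * real n - 1)) * log 2 (2 * real n))))))
      \<longlonglongrightarrow> 0 + (0 + (0 + (0 + 0)))" by (intro tendsto_add)
    then show ?thesis unfolding R_def u_def by (simp add: algebra_simps add_divide_distrib)
  qed
  then have "\<forall>\<^sub>F n in sequentially. R n < e" by (rule order_tendstoD) (rule e)
  moreover have "\<forall>\<^sub>F n in sequentially. 2 \<le> \<delta> * real n" using d0 by real_asymp
  ultimately show ?thesis
    using eventually_ge_at_top[of 1]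
  proof eventually_elim
    case (elim n)
    note n = elim(3)
    define N where "N = n choose (n div 2)"
    \<comment> \<open>\<open>m\<close> is rounded down to keep the supersaturation error small, and
      \<open>L\<close>, \<open>h\<close>, \<open>T\<close> are rounded up to satisfy lower bounds.
      The product of \<open>h\<close> and \<open>L\<close> has to reach
      \<open>c * N\<close>.\<close>
    define m where "m = nat \<lfloor>\<delta> * real n\<rfloor>"
    define L where "L = nat \<lceil>real n powr (1 / 4)\<rceil>"
    define h where "h = nat \<lceil>c * real N / real n powr (1 / 4)\<rceil>"
    define T where "T = nat \<lceil>(real k - 1 + e) * real N\<rceil>"
    have N0: "0 < real N" by (simp add: N_def)
    have pn: "2 ^ n \<le> 2 * sqrt (real n) * real N" using power2_le_central_binomial[OF n] by (simp add: N_def)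
    have uN: "1 \<le> u n * real N" using pn by (simp add: u_def field_simps)
    have u0: "0 \<le> u n" by (simp add: u_def)
    have q: "1 \<le> real n powr (1 / 4)" using n by (simp add: ge_one_powr_ge_zero)
    have m: "\<delta> * real n - 1 \<le> real m" "real m \<le> \<delta> * real n"
      using elim(2) unfolding m_def by linarith+
    have L: "real n powr (1 / 4) \<le> real L" "real L \<le> real n powr (1 / 4) + 1"
      using q unfolding L_def by linarith+
    have h0: "0 \<le> c * real N / real n powr (1 / 4)" using c0 by simp
    then have h: "c * real N / real n powr (1 / 4) \<le> real h" "real h \<le> c * real N / real n powr (1 / 4) + 1"
      unfolding h_def by linarith+
    have T0: "0 \<le> (real k - 1 + e) * real N" using e k2 by simp
    then have T: "(real k - 1 + e) * real N \<le> real T" "real T \<le> (real k - 1 + e) * real N + 1"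
      unfolding T_def by linarith+
    have hL: "2 * (p * (k * k * (k * p * N))) \<le> h * L"
    proof -
      have "real (2 * (p * (k * k * (k * p * N)))) = c * real N" by (simp add: c_def)
      also have "\<dots> = c * real N / real n powr (1 / 4) * real n powr (1 / 4)" using q n by simp
      also have "\<dots> \<le> real h * real L" by (rule mult_mono) (use h L in auto)
      finally show ?thesis by (simp only: of_nat_mult[symmetric] of_nat_le_iff)
    qed
    have super: "real m * (4 / real n) * (1 + real (k - 1) * s) < s - real (k - 1)"
      if s: "real T < s * real N" for s
    proof -
      have "(real k - 1 + e) * real N < s * real N" using s T by linarith
      then have s1: "real k - 1 + e < s" using N0 by simp
      then have s2: "1 \<le> s" using k2 e by linarith
      have k1: "real (k - 1) = real k - 1" using k2 by simp
      have "real m * (4 / real n) \<le> \<delta> * real n * (4 / real n)" using m by (intro mult_right_mono) auto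
      also have "\<dots> = 4 * \<delta>" using n by simp
      finally have a: "real m * (4 / real n) \<le> 4 * \<delta>" .
      have b: "1 + real (k - 1) * s \<le> real k * s" using s2 unfolding k1 by (simp add: algebra_simps)
      have "real m * (4 / real n) * (1 + real (k - 1) * s) \<le> 4 * \<delta> * (real k * s)"
        by (rule mult_mono[OF a b]) (use d0 s2 in auto)
      also have "\<dots> = e / (2 * real k) * s" using k2 by (simp add: \<delta>_def field_simps)
      also have "\<dots> < s - real (k - 1)"
      proof -
        have "e / (2 * real k) \<le> 1 / 2" using e k2 by (simp add: field_simps)
        then have "(real k - 1 + e) * (1 - e / (2 * real k)) < s * (1 - e / (2 * real k))"
          using s1 by (intro mult_strict_right_mono) auto
        \<comment> \<open>The surplus \<open>e\<close> of \<open>s\<close> over \<open>k - 1\<close>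
          outweighs the loss, which is at most \<open>e / 2\<close>.\<close>
        moreover have "real k - 1 < (real k - 1 + e) * (1 - e / (2 * real k))"
        proof -
          have "(real k - 1 + e) * (e / (2 * real k)) \<le> real k * (e / (2 * real k))"
            using e k2 by (intro mult_right_mono) auto
          also have "\<dots> = e / 2" using k2 by simp
          finally show ?thesis using e by (simp only: right_diff_distrib mult_1_right)
        qed
        ultimately show ?thesis unfolding k1 by (simp add: algebra_simps)
      qed
      finally show ?thesis .
    qed
    define O' where "O' = card (outer_sets {1..n})"
    \<comment> \<open>With \<open>mu = 2 * n\<close> the condition
      \<open>1 + 2 / mu \<le> lam\<close> is an equality for \<open>lam = 1 + 1 / n\<close>; even
      2^n such factors amount only to O(N / sqrt n) bits.\<close>
    have le: "real (count_free P n) \<le>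
      2 ^ O' * (real n ^ h * (1 + 1 / real n) ^ (2 ^ n)) *
      (2 ^ T * (1 + 1 / real n) ^ (2 ^ n) * (2 * real n) ^ ((k + k * L) * (2 ^ n div m)))"
    proof -
      have "1 \<le> m" "1 \<le> L" using m L q elim(2) by linarith+
      then show ?thesis
        using card_poset_free_le[OF tree, of "{1..n}" m L "real n" "2 * real n" "1 + 1 / real n" T h] n k super hL
        by (simp add: O'_def k_def p_def N_def)
    qed
    have "poset_free P (inclusion_order {})" by (rule empty_poset_free[OF tree])
    then have "{} \<in> {\<F> :: nat set set. \<F> \<subseteq> Pow {1..n} \<and> poset_free P (inclusion_order \<F>)}" by simp
    then have "0 < count_free P n" using finite_free_families by (metis card_gt_0_iff empty_iff)
    then have "log 2 (real (count_free P n)) \<le> log 2 (2 ^ O' * (real n ^ h * (1 + 1 / real n) ^ (2 ^ n)) *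
      (2 ^ T * (1 + 1 / real n) ^ (2 ^ n) * (2 * real n) ^ ((k + k * L) * (2 ^ n div m))))"
      using le by (intro log_mono) auto
    also have "\<dots> = real O' + (real h * log 2 (real n) + 2 ^ n * log 2 (1 + 1 / real n))
       + (real T + 2 ^ n * log 2 (1 + 1 / real n) + real ((k + k * L) * (2 ^ n div m)) * log 2 (2 * real n))"
    proof -
      have "0 < 1 + 1 / real n" by (simp add: add_pos_nonneg)
      then show ?thesis using n by (simp add: log_mult log_nat_power distrib_left)
    qed
    also have "\<dots> \<le> (real k - 1 + e + R n) * real N"
    proof -
      have 1: "real O' \<le> (1 + 3 ^ n / 2 powr (3 * real n / 4)) * u n * real N"
      proof -
        have "real O' \<le> (1 + 3 ^ n / 2 powr (3 * real n / 4)) * 1"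
          using card_outer_sets_le[of "{1..n}"] by (simp add: O'_def)
        also have "\<dots> \<le> (1 + 3 ^ n / 2 powr (3 * real n / 4)) * (u n * real N)"
          using uN by (intro mult_left_mono) auto
        finally show ?thesis by (simp add: mult.assoc)
      qed
      have 2: "real h * log 2 (real n) \<le> (c / real n powr (1 / 4) + u n) * log 2 (real n) * real N"
      proof -
        have "real h \<le> (c / real n powr (1 / 4) + u n) * real N"
          using h(2) uN by (simp add: algebra_simps)
        then have "real h * log 2 (real n) \<le> (c / real n powr (1 / 4) + u n) * real N * log 2 (real n)"
          using n by (intro mult_right_mono) auto
        then show ?thesis by (simp add: mult_ac)
      qed
      have 3: "2 ^ n * log 2 (1 + 1 / real n) \<le> 2 * sqrt (real n) * log 2 (1 + 1 / real n) * real N"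
      proof -
        have "1 \<le> 1 + 1 / real n" by simp
        then have "0 \<le> log 2 (1 + 1 / real n)" by (subst zero_le_log_cancel_iff) (auto simp: add_pos_nonneg)
        from mult_right_mono[OF pn this] show ?thesis by (simp only: mult_ac)
      qed
      have 4: "real T \<le> (real k - 1 + e + u n) * real N" using T(2) uN by (simp add: algebra_simps)
      have 5: "real ((k + k * L) * (2 ^ n div m)) * log 2 (2 * real n) \<le>
        (2 * real k + real k * real n powr (1 / 4)) * (2 * sqrt (real n) / (\<delta> * real n - 1)) * log 2 (2 * real n) * real N"
      proof -
        have "real (2 ^ n div m) \<le> 2 ^ n / real m" using of_nat_div_le_of_nat[of "2 ^ n" m, where 'a = real] by simp
        also have "\<dots> \<le> 2 * sqrt (real n) * real N / (\<delta> * real n - 1)"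
          using pn m elim(2) by (intro frac_le) auto
        finally have a: "real (2 ^ n div m) \<le> 2 * sqrt (real n) * real N / (\<delta> * real n - 1)" .
        have "real k * real L \<le> real k * (real n powr (1 / 4) + 1)" using L by (intro mult_left_mono) auto
        then have "real (k + k * L) \<le> 2 * real k + real k * real n powr (1 / 4)" by (simp add: algebra_simps)
        then have "real (k + k * L) * real (2 ^ n div m) \<le>
           (2 * real k + real k * real n powr (1 / 4)) * (2 * sqrt (real n) * real N / (\<delta> * real n - 1))"
          using a by (intro mult_mono) auto
        then have "real (k + k * L) * real (2 ^ n div m) * log 2 (2 * real n) \<le>
           (2 * real k + real k * real n powr (1 / 4)) * (2 * sqrt (real n) * real N / (\<delta> * real n - 1)) * log 2 (2 * real n)"
          using n by (intro mult_right_mono) auto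
        then show ?thesis by (simp add: mult_ac)
      qed
      show ?thesis using 1 2 3 4 5 unfolding R_def by (simp only: distrib_right)
    qed
    also have "\<dots> \<le> (real k - 1 + 2 * e) * real N"
      using elim(1) by (intro mult_right_mono) auto
    finally show ?case by (simp add: k_def N_def)
  qed
qed

text \<open>Here the exponent of the theorem vanishes and no error term can help, so the count must
  be exact. For chains of length 1 the richness condition is vacuous, so any single set already
  yields an embedding of \<open>P\<close>.\<close>

lemma count_free_height_1:
  assumes tree: "tree_poset P" and k: "poset_height P = 1"
  shows "count_free P n = 1"
proof -
  have finP: "finite (Field P)" and po: "Partial_order P" using tree by (auto simp: tree_poset_def)
  have "\<not> poset_free P (inclusion_order \<F>)" if v: "v \<in> \<F>" for v and \<F> :: "nat set set"
  proof -
    obtain \<phi> where "inj_on \<phi> (Field P)" "\<phi> ` Field P \<subseteq> (\<Union>c\<in>{[v]}. set c)" "\<And>x y. (x, y) \<in> P \<Longrightarrow> \<phi> x \<le> \<phi> y"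
      by (rule tree_embeds_in_rich_chains[OF tree, of "poset_rank P" 1 "{[v]}"])
        (use poset_rank_mono[OF finP po] poset_rank_less_height[OF finP po] k in auto)
    then have "poset_contains (inclusion_order \<F>) P" by (intro poset_containsI[of \<phi>]) (use v in auto)
    then show ?thesis by simp
  qed
  then have "{\<F> :: nat set set. \<F> \<subseteq> Pow {1..n} \<and> poset_free P (inclusion_order \<F>)} = {{}}"
    using empty_poset_free[OF tree] by auto
  then show ?thesis by simp
qed

theorem theorem1p4:
  fixes P :: "'a rel" and k :: nat
  assumes "tree_poset P" and "poset_height P = k"
  shows "\<exists>\<epsilon> :: nat \<Rightarrow> real. \<epsilon> \<in> o(\<lambda>_. 1) \<and>
           (\<forall>n. real (card {\<F> :: nat set set. \<F> \<subseteq> Pow {1..n} \<and> poset_free P (inclusion_order \<F>)})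
                  = 2 powr ((1 + \<epsilon> n) * (real k - 1) * real (n choose (n div 2))))"
proof (cases "k = 1")
  case True
  then show ?thesis using count_free_height_1[OF assms(1)] assms(2) by (intro exI[of _ "\<lambda>_. 0"]) auto
next
  case False
  have finP: "finite (Field P)" and po: "Partial_order P" using assms(1) by (auto simp: tree_poset_def)
  have k: "2 \<le> k" using poset_height_pos[OF assms(1)] assms(2) False by simp
  let ?N = "\<lambda>n. real (n choose (n div 2))"
  let ?l = "\<lambda>n. log 2 (real (count_free P n))"
  \<comment> \<open>Obtained by solving the claimed equation, which therefore holds exactly for
    every \<open>n\<close>; the empty family keeps the logarithm meaningful.\<close>
  define \<epsilon> where "\<epsilon> n = ?l n / ((real k - 1) * ?N n) - 1" for n
  have N: "0 < ?N n" for n by simp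
  have lower: "(\<Sum>i<k - 1. real (n choose (n div 2 + i))) \<le> ?l n" for n
  proof -
    have "2 ^ (\<Sum>i<k - 1. n choose (n div 2 + i)) \<le> count_free P n"
      using count_free_lower[OF finP po, of n] assms(2) k by simp
    then have "real (2 ^ (\<Sum>i<k - 1. n choose (n div 2 + i))) \<le> real (count_free P n)"
      by (simp only: of_nat_le_iff)
    then have "log 2 (2 ^ (\<Sum>i<k - 1. n choose (n div 2 + i))) \<le> ?l n"
      by (intro log_mono) auto
    then show ?thesis by (simp add: log_nat_power)
  qed
  have count: "real (count_free P n) = 2 powr ((1 + \<epsilon> n) * (real k - 1) * ?N n)" for n
  proof -
    have "{} \<in> {\<F> :: nat set set. \<F> \<subseteq> Pow {1..n} \<and> poset_free P (inclusion_order \<F>)}"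
      using empty_poset_free[OF assms(1)] by simp
    then have "0 < count_free P n" using finite_free_families by (metis card_gt_0_iff empty_iff)
    moreover have "(1 + \<epsilon> n) * (real k - 1) * ?N n = ?l n"
      using N[of n] k by (simp add: \<epsilon>_def)
    ultimately show ?thesis by simp
  qed
  have "\<epsilon> \<longlonglongrightarrow> 0"
  proof (rule tendstoI)
    fix d :: real assume d: "0 < d"
    define e where "e = min 1 (d / 4)"
    have e: "0 < e" "e \<le> 1" "2 * e < d" using d by (auto simp: e_def)
    have "(\<lambda>n. (\<Sum>i<k - 1. real (n choose (n div 2 + i)) / ?N n)) \<longlonglongrightarrow> (\<Sum>i<k - 1. 1)"
      by (intro tendsto_sum near_central_binomial_tendsto)
    then have "(\<lambda>n. (\<Sum>i<k - 1. real (n choose (n div 2 + i)) / ?N n)) \<longlonglongrightarrow> real k - 1"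
      using k by simp
    moreover have "real k - 1 - d < real k - 1" using d by simp
    ultimately have "\<forall>\<^sub>F n in sequentially. real k - 1 - d < (\<Sum>i<k - 1. real (n choose (n div 2 + i)) / ?N n)"
      by (rule order_tendstoD)
    moreover have "\<forall>\<^sub>F n in sequentially. ?l n \<le> (real k - 1 + 2 * e) * ?N n"
      using eventually_log_count_free_le[OF assms(1) _ e(1,2)] k assms(2) by simp
    ultimately show "\<forall>\<^sub>F n in sequentially. dist (\<epsilon> n) 0 < d"
    proof eventually_elim
      case (elim n)
      have k1: "1 \<le> real k - 1" using k by simp
      have "(\<Sum>i<k - 1. real (n choose (n div 2 + i)) / ?N n) \<le> ?l n / ?N n"
        using lower[of n] N[of n] by (simp only: sum_divide_distrib[symmetric] divide_right_mono less_imp_le)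
      then have lo: "real k - 1 - d < ?l n / ?N n" using elim(1) by linarith
      have "?l n / ?N n \<le> real k - 1 + 2 * e" using elim(2) N[of n] by (simp only: pos_divide_le_eq)
      then have up: "?l n / ?N n < real k - 1 + d" using e(3) by linarith
      have "\<epsilon> n = (?l n / ?N n - (real k - 1)) / (real k - 1)"
        using k1 by (simp add: \<epsilon>_def field_simps)
      then have "\<bar>\<epsilon> n\<bar> = \<bar>?l n / ?N n - (real k - 1)\<bar> / (real k - 1)" using k1 by simp
      \<comment> \<open>\<open>k\<close> is at least 2, so dividing by \<open>k - 1\<close> can only
        help.\<close>
      also have "\<dots> \<le> \<bar>?l n / ?N n - (real k - 1)\<bar> / 1" using k1 by (intro frac_le) auto
      also have "\<dots> < d" using lo up by (simp only: div_by_1)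
      finally show ?case by simp
    qed
  qed
  then have "\<epsilon> \<in> o(\<lambda>_. 1)" by (intro smalloI_tendsto) auto
  then show ?thesis using count by blast
qed

end
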